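(* Let $p = h\times w$, let $G=(V,E)$ with $V=\{1,\dots,p\}$ be the pixel adjacency graph of an $h\times w$ image, and let $D:\mathbb{R}^p\to\mathbb{R}^{E}$ be its graph difference matrix, $(Du)(i,j)=u_i-u_j$ for $(i,j)\in E$. Let $u_k\in\mathbb{R}^p$ and $\gamma_k\in\mathbb{R}^{E}$ be given, let $S_k:=\mathrm{supp}(\gamma_k)\subseteq E$, and let $S_k^c = E\setminus S_k$. Define $$\widetilde{u}_k := \mathrm{proj}_{S_k}(u_k):=\arg\min_{u'\in\mathbb{R}^p:\; D_{S_k^c}u'=0}\Vert u'-u_k\Vert_2 .$$ Suppose the graph $G_{S_k^c}=(V,E_{S_k^c})$ has $C$ connected components $G_1=(V_1,E_1),\dots,G_C=(V_C,E_C)$, so that $V=V_1\cup\dots\cup V_C$. Then $\widetilde{u}_k$ is given by $$\widetilde{u}_k(j)=\overline{u}_k(V_c):=\frac{1}{|V_c|}\sum_{l\in V_c}u_k(l)\qquad\text{for all } j\in V_c,\ c\in\{1,\dots,C\},$$ and $\widetilde{u}_k$ can be determined in this way (from $u_k$ and $S_k$) with a complexity of $\mathcal{O}(p)$.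
   Context: An image of height $h$ and width $w$ is identified with a vector in $\mathbb{R}^p$, $p=h\times w$. The vertex set $V=\{1,\dots,p\}$ indexes the pixels, and $E$ is the set of pairs $(i,j)$ of adjacent pixels in the $h\times w$ grid (each pixel has at most an absolute constant number of neighbours, so $|E|=\mathcal{O}(p)$). The rows of the matrix $D$ are indexed by $E$. For a vector $\gamma\in\mathbb{R}^E$, $\mathrm{supp}(\gamma)=\{e\in E:\gamma(e)\neq 0\}$. For a subset $S\subseteq E$, $D_S$ denotes the sub-matrix of $D$ consisting of the rows indexed by $S$, and $E_S$ denotes the set of edges of $G$ indexed by $S$; thus $D_{S_k^c}u'=0$ means $u'(i)=u'(j)$ for all $(i,j)\in E_{S_k^c}$. The vectors $u_k,\gamma_k$ arise as the $k$-th iterates of an iterative algorithm, but here they are simply given. Complexity counts elementary operations (arithmetic operations on real numbers and graph operations), including the cost of finding the connected components of $G_{S_k^c}$. *)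

theory Defs
  imports
    "HOL-Analysis.L2_Norm"
    "HOL-Library.FuncSet"
    "HOL-Library.Landau_Symbols"
    "Graph_Theory.Digraph_Component"
begin

section \<open>The pixel grid and the projection\<close>

text \<open>
  Since \<open>p = h * w\<close> varies inside the statement, a vector indexed by a finite set \<open>A\<close> is an
  extensional function, i.e. an element of \<open>A \<rightarrow>\<^sub>E UNIV\<close>.  Pixels are numbered from 1, row by row.
\<close>

type_synonym edge = "nat \<times> nat"

definition pixels :: "nat \<Rightarrow> nat \<Rightarrow> nat set" where
  "pixels h w = {1..h * w}"

definition pixel_row :: "nat \<Rightarrow> nat \<Rightarrow> nat" where
  "pixel_row w i = (i - 1) div w"

definition pixel_col :: "nat \<Rightarrow> nat \<Rightarrow> nat" where
  "pixel_col w i = (i - 1) mod w"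

text \<open>
  Horizontally and vertically adjacent pixels; each edge occurs once, oriented to the right or
  downwards.
\<close>
definition grid_edges :: "nat \<Rightarrow> nat \<Rightarrow> edge set" where
  "grid_edges h w = {(i, j). i \<in> pixels h w \<and> j \<in> pixels h w \<and>
     (pixel_row w i = pixel_row w j \<and> pixel_col w j = pixel_col w i + 1 \<or>
      pixel_col w i = pixel_col w j \<and> pixel_row w j = pixel_row w i + 1)}"

definition vectors :: "'i set \<Rightarrow> ('i \<Rightarrow> real) set" where
  "vectors A = A \<rightarrow>\<^sub>E UNIV"

definition diff_op :: "edge set \<Rightarrow> (nat \<Rightarrow> real) \<Rightarrow> (edge \<Rightarrow> real)" where
  "diff_op E u = (\<lambda>(i, j)\<in>E. u i - u j)"

definition supp :: "edge set \<Rightarrow> (edge \<Rightarrow> real) \<Rightarrow> edge set" where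
  "supp E \<gamma> = {e \<in> E. \<gamma> e \<noteq> 0}"

definition feasible :: "nat \<Rightarrow> nat \<Rightarrow> edge set \<Rightarrow> (nat \<Rightarrow> real) \<Rightarrow> bool" where
  "feasible h w S u' \<longleftrightarrow> u' \<in> vectors (pixels h w) \<and>
     (\<forall>e \<in> grid_edges h w - S. diff_op (grid_edges h w) u' e = 0)"

definition distance :: "nat \<Rightarrow> nat \<Rightarrow> (nat \<Rightarrow> real) \<Rightarrow> (nat \<Rightarrow> real) \<Rightarrow> real" where
  "distance h w u u' = L2_set (\<lambda>i. u' i - u i) (pixels h w)"

definition projection :: "nat \<Rightarrow> nat \<Rightarrow> edge set \<Rightarrow> (nat \<Rightarrow> real) \<Rightarrow> (nat \<Rightarrow> real)" where
  "projection h w S u = (ARG_MIN (distance h w u) u'. feasible h w S u')"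

text \<open>
  The graph \<open>(V, E - S)\<close>.  The constant \<open>Digraph_Component.connected\<close> ignores the orientation of
  arcs, so the components below are those of the underlying undirected graph.
\<close>
definition cut_graph :: "nat \<Rightarrow> nat \<Rightarrow> edge set \<Rightarrow> (nat, edge) pre_digraph" where
  "cut_graph h w S = with_proj \<lparr>pverts = pixels h w, parcs = grid_edges h w - S\<rparr>"

definition components :: "('a, 'b) pre_digraph \<Rightarrow> ('a, 'b) pre_digraph set" where
  "components G = {H. pre_digraph.max_subgraph G Digraph_Component.connected H}"

definition mean :: "(nat \<Rightarrow> real) \<Rightarrow> nat set \<Rightarrow> real" where
  "mean u A = (\<Sum>l\<in>A. u l) / real (card A)"


section \<open>A real-number random access machine with unit costs\<close>

text \<open>
  A program manipulates natural-number and real-number variables and arrays.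
  Every expression node, test and command costs one unit.  To keep the unit-cost measure
  meaningful, natural numbers can only be added, subtracted (with truncation) and compared, the
  only real constants are 0 and 1, and real numbers never influence addresses or control flow.
\<close>

type_synonym vname = string

datatype iexp =
    IConst nat
  | IVar vname
  | IArr vname iexp
  | IPlus iexp iexp
  | IMinus iexp iexp

datatype rexp =
    RZero
  | ROne
  | RVar vname
  | RArr vname iexp
  | RPlus rexp rexp
  | RMinus rexp rexp
  | RTimes rexp rexp
  | RDivide rexp rexp

datatype cond =
    Less iexp iexp
  | Equal iexp iexp
  | Neg cond
  | Conj cond cond

datatype com =
    Skip
  | SetIVar vname iexp
  | SetIArr vname iexp iexp
  | SetRVar vname rexp
  | SetRArr vname iexp rexp
  | Seq com com
  | Cond cond com com
  | While cond com

record state =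
  ivar :: "vname \<Rightarrow> nat"
  iarr :: "vname \<Rightarrow> nat \<Rightarrow> nat"
  rvar :: "vname \<Rightarrow> real"
  rarr :: "vname \<Rightarrow> nat \<Rightarrow> real"

primrec ival :: "iexp \<Rightarrow> state \<Rightarrow> nat" where
  "ival (IConst n) s = n"
| "ival (IVar x) s = ivar s x"
| "ival (IArr a e) s = iarr s a (ival e s)"
| "ival (IPlus e f) s = ival e s + ival f s"
| "ival (IMinus e f) s = ival e s - ival f s"

primrec icost :: "iexp \<Rightarrow> nat" where
  "icost (IConst n) = 1"
| "icost (IVar x) = 1"
| "icost (IArr a e) = 1 + icost e"
| "icost (IPlus e f) = 1 + icost e + icost f"
| "icost (IMinus e f) = 1 + icost e + icost f"

primrec rval :: "rexp \<Rightarrow> state \<Rightarrow> real" where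
  "rval RZero s = 0"
| "rval ROne s = 1"
| "rval (RVar x) s = rvar s x"
| "rval (RArr a e) s = rarr s a (ival e s)"
| "rval (RPlus e f) s = rval e s + rval f s"
| "rval (RMinus e f) s = rval e s - rval f s"
| "rval (RTimes e f) s = rval e s * rval f s"
| "rval (RDivide e f) s = rval e s / rval f s"

primrec rcost :: "rexp \<Rightarrow> nat" where
  "rcost RZero = 1"
| "rcost ROne = 1"
| "rcost (RVar x) = 1"
| "rcost (RArr a e) = 1 + icost e"
| "rcost (RPlus e f) = 1 + rcost e + rcost f"
| "rcost (RMinus e f) = 1 + rcost e + rcost f"
| "rcost (RTimes e f) = 1 + rcost e + rcost f"
| "rcost (RDivide e f) = 1 + rcost e + rcost f"

primrec cval :: "cond \<Rightarrow> state \<Rightarrow> bool" where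
  "cval (Less e f) s \<longleftrightarrow> ival e s < ival f s"
| "cval (Equal e f) s \<longleftrightarrow> ival e s = ival f s"
| "cval (Neg b) s \<longleftrightarrow> \<not> cval b s"
| "cval (Conj b c) s \<longleftrightarrow> cval b s \<and> cval c s"

primrec ccost :: "cond \<Rightarrow> nat" where
  "ccost (Less e f) = 1 + icost e + icost f"
| "ccost (Equal e f) = 1 + icost e + icost f"
| "ccost (Neg b) = 1 + ccost b"
| "ccost (Conj b c) = 1 + ccost b + ccost c"

text \<open>\<open>exec c s t s'\<close>: started in \<open>s\<close>, the program \<open>c\<close> terminates in \<open>s'\<close> at total cost \<open>t\<close>.\<close>

inductive exec :: "com \<Rightarrow> state \<Rightarrow> nat \<Rightarrow> state \<Rightarrow> bool" where
  Skip: "exec Skip s 1 s"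
| SetIVar: "exec (SetIVar x e) s (1 + icost e) (s\<lparr>ivar := (ivar s)(x := ival e s)\<rparr>)"
| SetIArr: "exec (SetIArr a e f) s (1 + icost e + icost f)
    (s\<lparr>iarr := (iarr s)(a := (iarr s a)(ival e s := ival f s))\<rparr>)"
| SetRVar: "exec (SetRVar x e) s (1 + rcost e) (s\<lparr>rvar := (rvar s)(x := rval e s)\<rparr>)"
| SetRArr: "exec (SetRArr a e f) s (1 + icost e + rcost f)
    (s\<lparr>rarr := (rarr s)(a := (rarr s a)(ival e s := rval f s))\<rparr>)"
| Seq: "exec c s t s' \<Longrightarrow> exec d s' t' s'' \<Longrightarrow> exec (Seq c d) s (1 + t + t') s''"
| CondTrue: "cval b s \<Longrightarrow> exec c s t s' \<Longrightarrow> exec (Cond b c d) s (1 + ccost b + t) s'"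
| CondFalse: "\<not> cval b s \<Longrightarrow> exec d s t s' \<Longrightarrow> exec (Cond b c d) s (1 + ccost b + t) s'"
| WhileFalse: "\<not> cval b s \<Longrightarrow> exec (While b c) s (1 + ccost b) s"
| WhileTrue: "cval b s \<Longrightarrow> exec c s t s' \<Longrightarrow> exec (While b c) s' t' s'' \<Longrightarrow>
    exec (While b c) s (1 + ccost b + t + t') s''"

lemma exec_deterministic:
  "exec c s t s' \<Longrightarrow> exec c s u r \<Longrightarrow> u = t \<and> r = s'"
proof (induction arbitrary: u r rule: exec.induct)
  case (WhileFalse b s c)
  from WhileFalse.prems show ?case
    using WhileFalse.hyps by cases auto
next
  case (WhileTrue b s c t s' t' s'')
  from WhileTrue.prems show ?case
    by cases (use WhileTrue.hyps WhileTrue.IH in blast)+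
next
  case (Seq c s t s' d t' s'')
  from Seq.prems show ?case
    by cases (use Seq.IH in blast)
next
  case (CondTrue b s c t s' d)
  from CondTrue.prems show ?case
    by cases (use CondTrue.hyps CondTrue.IH in blast)+
next
  case (CondFalse b s d t s' c)
  from CondFalse.prems show ?case
    by cases (use CondFalse.hyps CondFalse.IH in blast)+
qed (erule exec.cases; simp; fail)+

text \<open>
  The input consists of \<open>h\<close>, \<open>w\<close>, \<open>u\<close> and the indicator function of \<open>S\<close>; the latter is stored at
  the left (upper) endpoint of every horizontal (vertical) edge.  All other memory cells are
  arbitrary, so a program cannot rely on memory being initialised.
\<close>
definition is_input :: "nat \<Rightarrow> nat \<Rightarrow> (nat \<Rightarrow> real) \<Rightarrow> edge set \<Rightarrow> state \<Rightarrow> bool" where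
  "is_input h w u S s \<longleftrightarrow>
     ivar s ''h'' = h \<and> ivar s ''w'' = w \<and>
     (\<forall>i \<in> pixels h w. rarr s ''u'' i = u i) \<and>
     (\<forall>(i, j) \<in> grid_edges h w.
        iarr s (if pixel_row w i = pixel_row w j then ''right'' else ''down'') i =
          of_bool ((i, j) \<in> S))"

text \<open>
  The output consists of the projected vector and of a labelling of the pixels by the connected
  components that were found.
\<close>
definition is_output :: "nat \<Rightarrow> nat \<Rightarrow> (nat \<Rightarrow> real) \<Rightarrow> edge set \<Rightarrow> state \<Rightarrow> bool" where
  "is_output h w u S s \<longleftrightarrow>
     (\<forall>i \<in> pixels h w. rarr s ''proj'' i = projection h w S u i) \<and>
     (\<forall>i \<in> pixels h w. \<forall>j \<in> pixels h w. iarr s ''component'' i = iarr s ''component'' j \<longleftrightarrow>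
        (\<exists>H \<in> components (cut_graph h w S). i \<in> verts H \<and> j \<in> verts H))"

end

theory Submission
  imports Defs "HOL-Real_Asymp.Real_Asymp"
begin

text \<open>
  The feasible vectors are exactly those constant on the connected components, and the vector \<open>m\<close> of
  component means satisfies \<open>v \<bullet> (m - u) = 0\<close> for each of them.  By Pythagoras
  \<open>\<parallel>v - u\<parallel>\<^sup>2 = \<parallel>v - m\<parallel>\<^sup>2 + \<parallel>m - u\<parallel>\<^sup>2\<close> for every feasible \<open>v\<close>, so \<open>m\<close> is the unique minimiser.
  In linear time, a breadth-first search labels the components: every pixel enters the queue once and
  has at most four neighbours.  One pass then accumulates the sum and the size of each component and
  a last pass divides.
\<close>

section \<open>Connected components as classes of linked vertices\<close>

text \<open>Components are given as maximal connected subgraphs, whereas both halves of the theorem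
  argue along walks. The bridge is that the components are exactly the subgraphs induced on the
  reachability classes of the symmetrised graph. The machine model shapes the program. Naturals
  cannot be multiplied or divided, so p and the column numbers arise by counting. Memory is
  arbitrary at the start, so every cell whose value matters has to be cleared or masked. Reals
  cannot be obtained from naturals, so component sizes are counted in real cells. To read the time
  bound off the program text, no loop contains another: the scan for a new starting pixel and the
  processing of the queue share one loop. Every loop then makes at most 2p passes of bounded cost,
  and the total is a constant of the program times p + 1.\<close>

abbreviation linked :: "('a, 'b) pre_digraph \<Rightarrow> 'a \<Rightarrow> 'a \<Rightarrow> bool" where
  "linked G i j \<equiv> reachable (with_proj (mk_symmetric G)) i j"

lemma linked_sym: "linked G i j \<Longrightarrow> linked G j i"
  by (rule symmetric_reachable[OF symmetric_mk_symmetric])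

context wf_digraph begin

interpretation sym: pair_wf_digraph "mk_symmetric G" ..

lemma linked_trans: "linked G i j \<Longrightarrow> linked G j k \<Longrightarrow> linked G i k"
  by (rule sym.reachable_trans)

lemma linked_in_verts: "linked G i j \<Longrightarrow> i \<in> verts G" "linked G i j \<Longrightarrow> j \<in> verts G"
  using sym.reachable_in_verts[of i j] by auto

lemma linked_refl: "i \<in> verts G \<Longrightarrow> linked G i i"
  by (rule sym.reachable_refl) simp

text \<open>Every vertex on a walk from \<open>i\<close> is itself linked to \<open>i\<close>, so
  the walk survives the restriction to the class. Two arbitrary members are then joined through
  \<open>i\<close>.\<close>

lemma linked_class_connected:
  assumes "i \<in> verts G"
  shows "Digraph_Component.connected (G \<restriction> {j. linked G i j})"
proof -
  let ?H = "G \<restriction> {j. linked G i j}"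
  have i: "linked G i i"
    using assms by (rule linked_refl)
  have *: "linked ?H i j" if "linked G i j" for j
    using that
  proof (induction rule: sym.reachable_induct)
    case base
    show ?case
      using i by (auto simp: reachable_def)
  next
    case (step x y)
    then have "linked G i y"
      using sym.reachable_adj_trans by blast
    moreover have "(x, y) \<in> parcs (mk_symmetric ?H)"
      using step(1,2) \<open>linked G i y\<close> by (auto simp: parcs_mk_symmetric)
    ultimately show ?case
      using step.IH unfolding reachable_def by (auto intro: rtrancl_on_into_rtrancl_on)
  qed
  interpret H: wf_digraph ?H ..
  show ?thesis
    unfolding Digraph_Component.connected_def
  proof (rule strongly_connectedI)
    show "verts (with_proj (mk_symmetric ?H)) \<noteq> {}"
      using i by auto
    fix x y
    assume "x \<in> verts (with_proj (mk_symmetric ?H))" "y \<in> verts (with_proj (mk_symmetric ?H))"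
    then have "linked ?H i x" "linked ?H i y"
      using * by auto
    then show "linked ?H x y"
      by (blast intro: H.linked_trans linked_sym)
  qed
qed

lemma linked_class_subgraph: "subgraph (G \<restriction> {j. linked G i j}) G"
  by (intro induced_imp_subgraph induced_induce) (auto dest: linked_in_verts)

text \<open>A walk inside \<open>H\<close> is also a walk in \<open>G\<close>. Hence the class of
  \<open>i\<close> induces the largest connected subgraph containing \<open>i\<close>, which is what
  maximality needs in both directions.\<close>

lemma connected_subgraph_linked_class:
  assumes "subgraph H G" "Digraph_Component.connected H" "i \<in> verts H"
  shows "subgraph H (G \<restriction> {j. linked G i j})"
proof -
  have "linked G i j" if "j \<in> verts H" for j
  proof -
    have "linked H i j"
      using assms that unfolding Digraph_Component.connected_def by auto
    then show ?thesis
      by (rule sym.reachable_mono[OF _ subgraph_mk_symmetric[OF assms(1)]])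
  qed
  then have sub: "verts H \<subseteq> {j. linked G i j}"
    by auto
  have "wf_digraph H" "compatible G H" "arcs H \<subseteq> arcs G"
    using assms(1) by auto
  then show ?thesis
    using sub wf_digraph.wellformed[OF \<open>wf_digraph H\<close>]
    by (intro subgraphI) (auto simp: compatible_def)
qed

lemma linked_class_in_components:
  assumes "i \<in> verts G"
  shows "G \<restriction> {j. linked G i j} \<in> components G"
  unfolding components_def mem_Collect_eq
proof (rule max_subgraphI)
  show "Digraph_Component.connected (G \<restriction> {j. linked G i j})"
    using assms by (rule linked_class_connected)
  show "subgraph (G \<restriction> {j. linked G i j}) G"
    by (rule linked_class_subgraph)
  let ?H = "G \<restriction> {j. linked G i j}"
  fix H
  assume H: "?H \<noteq> H" "subgraph ?H H" "subgraph H G"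
  have "i \<in> verts ?H"
    using assms by (simp add: linked_refl)
  then have "i \<in> verts H"
    using subgraph_imp_subverts[OF H(2)] by auto
  show "\<not> Digraph_Component.connected H"
  proof
    assume "Digraph_Component.connected H"
    then have "subgraph H ?H"
      using H(3) \<open>i \<in> verts H\<close> by (intro connected_subgraph_linked_class)
    \<comment> \<open>The subgraph order is antisymmetric: mutual inclusion settles vertices and
      arcs, compatibility settles \<open>tail\<close> and \<open>head\<close>.\<close>
    then have "?H = H"
      using H(2) by (auto simp: subgraph_def compatible_def)
    with H(1) show False ..
  qed
qed

text \<open>\<open>H\<close> lies below the class of any of its vertices, and the class is
  connected, so maximality of \<open>H\<close> forces equality.\<close>

lemma verts_component:
  assumes "H \<in> components G" "i \<in> verts H"
  shows "verts H = {j. linked G i j}"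
proof -
  let ?H = "G \<restriction> {j. linked G i j}"
  have H: "max_subgraph Digraph_Component.connected H"
    using assms by (simp add: components_def)
  then have "subgraph H G" "Digraph_Component.connected H"
    by (simp_all add: max_subgraph_def)
  then have "subgraph H ?H" "i \<in> verts G"
    using connected_subgraph_linked_class assms(2) by (auto dest: subgraph_imp_subverts)
  moreover have "max_subgraph Digraph_Component.connected ?H"
    using linked_class_in_components[OF \<open>i \<in> verts G\<close>] by (simp add: components_def)
  ultimately have "H = ?H"
    using H max_subgraph_subg_eq by blast
  then show ?thesis
    by (metis induce_subgraph_verts)
qed

lemma linked_iff_component:
  "linked G i j \<longleftrightarrow> (\<exists>H\<in>components G. i \<in> verts H \<and> j \<in> verts H)"
proof
  assume ij: "linked G i j"
  then have "i \<in> verts G"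
    by (rule linked_in_verts)
  then show "\<exists>H\<in>components G. i \<in> verts H \<and> j \<in> verts H"
    using ij by (intro bexI[OF _ linked_class_in_components]) (auto simp: linked_refl)
next
  assume "\<exists>H\<in>components G. i \<in> verts H \<and> j \<in> verts H"
  then show "linked G i j"
    using verts_component by auto
qed

lemma Union_verts_components: "(\<Union>H\<in>components G. verts H) = verts G"
proof
  show "(\<Union>H\<in>components G. verts H) \<subseteq> verts G"
    using linked_iff_component linked_in_verts by blast
  show "verts G \<subseteq> (\<Union>H\<in>components G. verts H)"
    using linked_refl linked_iff_component by blast
qed

end

section \<open>The projection averages over components\<close>

lemma grid_edges_in_pixels: "grid_edges h w \<subseteq> pixels h w \<times> pixels h w"
  by (auto simp: grid_edges_def)

lemma finite_pixels [simp]: "finite (pixels h w)"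
  by (simp add: pixels_def)

lemma cut_graph_simps [simp]:
  "verts (cut_graph h w S) = pixels h w" "arcs (cut_graph h w S) = grid_edges h w - S"
  "tail (cut_graph h w S) = fst" "head (cut_graph h w S) = snd"
  by (simp_all add: cut_graph_def)

lemma wf_digraph_cut_graph [simp]: "wf_digraph (cut_graph h w S)"
  by unfold_locales (use grid_edges_in_pixels[of h w] in auto)

lemmas linked_simps =
  wf_digraph.linked_trans[OF wf_digraph_cut_graph]
  wf_digraph.linked_in_verts[OF wf_digraph_cut_graph, simplified]
  wf_digraph.linked_refl[OF wf_digraph_cut_graph, simplified]

lemma parcs_mk_symmetric_cut_graph:
  "(i, j) \<in> parcs (mk_symmetric (cut_graph h w S)) \<longleftrightarrow>
     (i, j) \<in> grid_edges h w - S \<or> (j, i) \<in> grid_edges h w - S"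
proof -
  have "(i, j) \<in> parcs (mk_symmetric (cut_graph h w S)) \<longleftrightarrow>
      (\<exists>e\<in>grid_edges h w - S. (i, j) = (fst e, snd e) \<or> (i, j) = (snd e, fst e))"
    by (simp only: parcs_mk_symmetric cut_graph_simps UN_iff insert_iff empty_iff simp_thms)
  also have "\<dots> \<longleftrightarrow> (i, j) \<in> grid_edges h w - S \<or> (j, i) \<in> grid_edges h w - S"
    unfolding Pair_inject by (metis fst_conv snd_conv prod.collapse)
  finally show ?thesis .
qed

text \<open>The tool for local-to-global arguments: whatever is constant along undirected edges is
  constant on classes. It serves both feasible vectors and computed labels.\<close>

lemma linked_induct [consumes 1, case_names refl edge]:
  assumes "linked (cut_graph h w S) i j"
    and "P i"
    and "\<And>x y. (x, y) \<in> grid_edges h w - S \<or> (y, x) \<in> grid_edges h w - S \<Longrightarrow> P x \<Longrightarrow> P y"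
  shows "P j"
  using assms(1) unfolding reachable_def
  by (induction rule: rtrancl_on_induct) (use assms(2,3) in \<open>auto simp: parcs_mk_symmetric_cut_graph\<close>)

lemma linked_edge:
  assumes "(i, j) \<in> grid_edges h w - S \<or> (j, i) \<in> grid_edges h w - S"
  shows "linked (cut_graph h w S) i j"
proof -
  have "i \<in> pixels h w" "j \<in> pixels h w"
    using assms grid_edges_in_pixels[of h w] by auto
  moreover have "(i, j) \<in> parcs (mk_symmetric (cut_graph h w S))"
    using assms by (simp add: parcs_mk_symmetric_cut_graph)
  ultimately show ?thesis
    unfolding reachable_def
    by (auto intro: rtrancl_on_into_rtrancl_on)
qed

lemma feasible_iff_linked:
  "feasible h w S v \<longleftrightarrow>
     v \<in> vectors (pixels h w) \<and> (\<forall>i j. linked (cut_graph h w S) i j \<longrightarrow> v i = v j)"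
proof (intro iffI conjI allI impI)
  assume f: "feasible h w S v"
  then show "v \<in> vectors (pixels h w)"
    by (simp add: feasible_def)
  fix i j
  assume "linked (cut_graph h w S) i j"
  then show "v i = v j"
  proof (induction rule: linked_induct)
    case (edge x y)
    have "v a = v b" if "(a, b) \<in> grid_edges h w - S" for a b
    proof -
      have "diff_op (grid_edges h w) v (a, b) = 0"
        using f that unfolding feasible_def by blast
      then show ?thesis
        using that by (simp add: diff_op_def)
    qed
    then have "v x = v y"
      using edge(1) by fastforce
    then show ?case
      using edge(2) by simp
  qed simp
next
  assume "v \<in> vectors (pixels h w) \<and> (\<forall>i j. linked (cut_graph h w S) i j \<longrightarrow> v i = v j)"
  then show "feasible h w S v"
    using linked_edge unfolding feasible_def diff_op_def by auto
qed

text \<open>The restriction to pixels makes the function extensional, hence a member of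
  \<open>vectors\<close>; otherwise it could not be the minimiser.\<close>

definition class_mean :: "nat \<Rightarrow> nat \<Rightarrow> edge set \<Rightarrow> (nat \<Rightarrow> real) \<Rightarrow> nat \<Rightarrow> real" where
  "class_mean h w S u = (\<lambda>i\<in>pixels h w. mean u {j. linked (cut_graph h w S) i j})"

lemma linked_class_eq:
  "linked (cut_graph h w S) i j \<Longrightarrow>
     {k. linked (cut_graph h w S) i k} = {k. linked (cut_graph h w S) j k}"
  by (auto intro: linked_simps(1) linked_sym)

lemma feasible_class_mean: "feasible h w S (class_mean h w S u)"
  unfolding feasible_iff_linked
  by (auto simp: class_mean_def vectors_def linked_class_eq dest: linked_simps(2,3))

text \<open>Averaging over classes is self-adjoint and fixes feasible vectors. Concretely, swap the
  double sum over linked pairs: \<open>v\<close> and the class size are constant on a class, so each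
  \<open>l\<close> contributes \<open>v l * u l\<close> once per member of its class, divided by the
  number of members.\<close>

lemma sum_mult_class_mean:
  assumes "feasible h w S v"
  shows "(\<Sum>i\<in>pixels h w. v i * class_mean h w S u i) = (\<Sum>i\<in>pixels h w. v i * u i)"
proof -
  let ?V = "pixels h w" and ?L = "linked (cut_graph h w S)"
  have cls: "{j. ?L i j} = {j \<in> ?V. ?L i j}" for i
    by (auto dest: linked_simps(3))
  have "(\<Sum>i\<in>?V. v i * class_mean h w S u i) =
      (\<Sum>i\<in>?V. \<Sum>l\<in>{l \<in> ?V. ?L i l}. v i * u l / card {j. ?L i j})"
    by (simp add: class_mean_def mean_def cls sum_distrib_left sum_divide_distrib)
  also have "\<dots> = (\<Sum>l\<in>?V. \<Sum>i\<in>{i \<in> ?V. ?L i l}. v i * u l / card {j. ?L i j})"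
    by (rule sum.swap_restrict) auto
  also have "\<dots> = (\<Sum>l\<in>?V. \<Sum>i\<in>{j. ?L l j}. v l * u l / card {j. ?L l j})"
  proof (intro sum.cong refl)
    fix l
    show "{i \<in> ?V. ?L i l} = {j. ?L l j}"
      by (auto dest: linked_sym linked_simps(3))
    fix i
    assume "i \<in> {j. ?L l j}"
    then show "v i * u l / card {j. ?L i j} = v l * u l / card {j. ?L l j}"
      using assms linked_class_eq[of h w S l i] by (auto simp: feasible_iff_linked)
  qed
  also have "\<dots> = (\<Sum>l\<in>?V. v l * u l)"
  proof (intro sum.cong refl)
    fix l
    assume "l \<in> ?V"
    then have "l \<in> {j. ?L l j}"
      by (simp add: linked_simps(4))
    moreover have "finite {j. ?L l j}"
      unfolding cls by simp
    ultimately have "card {j. ?L l j} \<noteq> 0"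
      by auto
    then show "(\<Sum>i\<in>{j. ?L l j}. v l * u l / card {j. ?L l j}) = v l * u l"
      by simp
  qed
  finally show ?thesis .
qed

lemma distance_pythagoras:
  assumes "feasible h w S v"
  shows "(distance h w u v)\<^sup>2 =
    (distance h w (class_mean h w S u) v)\<^sup>2 + (distance h w u (class_mean h w S u))\<^sup>2"
proof -
  let ?V = "pixels h w" and ?m = "class_mean h w S u"
  have sq: "(distance h w a b)\<^sup>2 = (\<Sum>i\<in>?V. (b i - a i)\<^sup>2)" for a b
    by (simp add: distance_def L2_set_def sum_nonneg)
  have 1: "(\<Sum>i\<in>?V. v i * (?m i - u i)) = 0"
    using sum_mult_class_mean[OF assms, of u] by (simp add: right_diff_distrib sum_subtractf)
  have 2: "(\<Sum>i\<in>?V. ?m i * (?m i - u i)) = 0"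
    using sum_mult_class_mean[OF feasible_class_mean, of h w S u u]
    by (simp add: right_diff_distrib sum_subtractf)
  \<comment> \<open>Expansion of v - u = (v - m) + (m - u). The cross term splits into two inner
    products with m - u, and both vanish because \<open>v\<close> and the mean itself are
    feasible.\<close>
  have "(\<Sum>i\<in>?V. (v i - u i)\<^sup>2) =
    (\<Sum>i\<in>?V. (v i - ?m i)\<^sup>2 + (?m i - u i)\<^sup>2 + 2 * (v i * (?m i - u i)) - 2 * (?m i * (?m i - u i)))"
    by (intro sum.cong refl) (simp add: power2_eq_square algebra_simps)
  also have "\<dots> = (\<Sum>i\<in>?V. (v i - ?m i)\<^sup>2) + (\<Sum>i\<in>?V. (?m i - u i)\<^sup>2)
      + 2 * (\<Sum>i\<in>?V. v i * (?m i - u i)) - 2 * (\<Sum>i\<in>?V. ?m i * (?m i - u i))"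
    by (simp only: sum.distrib sum_subtractf sum_distrib_left)
  finally show ?thesis
    unfolding sq 1 2 by simp
qed

text \<open>Two distinct extensional vectors differ at some pixel, so the extra Pythagoras term is
  positive. As an equivalence this yields existence and uniqueness together, and leaves the choice
  in \<open>arg_min\<close> a single candidate.\<close>

lemma is_arg_min_distance_iff:
  "is_arg_min (distance h w u) (feasible h w S) v \<longleftrightarrow> v = class_mean h w S u"
proof -
  let ?m = "class_mean h w S u"
  have nonneg: "0 \<le> distance h w a b" for a b
    by (simp add: distance_def)
  have less: "distance h w u ?m < distance h w u v" if "feasible h w S v" "v \<noteq> ?m" for v
  proof -
    have "v \<in> vectors (pixels h w)" "?m \<in> vectors (pixels h w)"
      using that(1) feasible_class_mean by (auto simp: feasible_def)
    then have "\<exists>i\<in>pixels h w. v i \<noteq> ?m i"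
      using that(2) PiE_ext[of v "pixels h w" "\<lambda>_. UNIV" ?m] unfolding vectors_def by blast
    then have "distance h w ?m v \<noteq> 0"
      by (auto simp: distance_def L2_set_eq_0_iff)
    then have "(distance h w u ?m)\<^sup>2 < (distance h w u v)\<^sup>2"
      using distance_pythagoras[OF that(1), of u] by simp
    then show ?thesis
      using nonneg power_less_imp_less_base by blast
  qed
  show ?thesis
  proof
    assume v: "is_arg_min (distance h w u) (feasible h w S) v"
    then have "feasible h w S v" "\<not> distance h w u ?m < distance h w u v"
      using feasible_class_mean by (auto simp: is_arg_min_def)
    then show "v = ?m"
      using less by blast
  next
    assume "v = ?m"
    then show "is_arg_min (distance h w u) (feasible h w S) v"
      using less feasible_class_mean less_asym unfolding is_arg_min_def by blast
  qed
qed

lemma projection_eq_class_mean: "projection h w S u = class_mean h w S u"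
  by (simp add: projection_def arg_min_def is_arg_min_distance_iff)

lemma projection_component_mean:
  assumes "H \<in> components (cut_graph h w S)" "j \<in> verts H"
  shows "projection h w S u j = mean u (verts H)"
proof -
  interpret wf_digraph "cut_graph h w S"
    by simp
  have "j \<in> pixels h w"
    using Union_verts_components assms by auto
  then show ?thesis
    by (simp add: projection_eq_class_mean class_mean_def verts_component[OF assms])
qed

section \<open>Cost bounds for programs\<close>

text \<open>Meaningful for loop-free programs only; the equation for \<^const>\<open>While\<close> is a dummy.\<close>
primrec run :: "com \<Rightarrow> state \<Rightarrow> state" where
  "run Skip s = s"
| "run (SetIVar x e) s = s\<lparr>ivar := (ivar s)(x := ival e s)\<rparr>"
| "run (SetIArr a e f) s = s\<lparr>iarr := (iarr s)(a := (iarr s a)(ival e s := ival f s))\<rparr>"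
| "run (SetRVar x e) s = s\<lparr>rvar := (rvar s)(x := rval e s)\<rparr>"
| "run (SetRArr a e f) s = s\<lparr>rarr := (rarr s)(a := (rarr s a)(ival e s := rval f s))\<rparr>"
| "run (Seq c d) s = run d (run c s)"
| "run (Cond b c d) s = (if cval b s then run c s else run d s)"
| "run (While b c) s = s"

primrec loop_free :: "com \<Rightarrow> bool" where
  "loop_free Skip \<longleftrightarrow> True"
| "loop_free (SetIVar x e) \<longleftrightarrow> True"
| "loop_free (SetIArr a e f) \<longleftrightarrow> True"
| "loop_free (SetRVar x e) \<longleftrightarrow> True"
| "loop_free (SetRArr a e f) \<longleftrightarrow> True"
| "loop_free (Seq c d) \<longleftrightarrow> loop_free c \<and> loop_free d"
| "loop_free (Cond b c d) \<longleftrightarrow> loop_free c \<and> loop_free d"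
| "loop_free (While b c) \<longleftrightarrow> False"

text \<open>
  \<open>slope c * (p + 1)\<close> bounds the cost of a program all of whose loops make at most \<open>2 * p\<close> passes
  and whose loop bodies are loop-free; for a loop-free \<open>c\<close> already \<open>slope c\<close> is a bound.
\<close>
primrec slope :: "com \<Rightarrow> nat" where
  "slope Skip = 1"
| "slope (SetIVar x e) = 1 + icost e"
| "slope (SetIArr a e f) = 1 + icost e + icost f"
| "slope (SetRVar x e) = 1 + rcost e"
| "slope (SetRArr a e f) = 1 + icost e + rcost f"
| "slope (Seq c d) = 1 + slope c + slope d"
| "slope (Cond b c d) = 1 + ccost b + slope c + slope d"
| "slope (While b c) = 2 * (1 + ccost b + slope c)"

lemma exec_run: "loop_free c \<Longrightarrow> \<exists>t\<le>slope c. exec c s t (run c s)"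
proof (induction c arbitrary: s)
  case (Seq c d)
  then obtain t t' where "t \<le> slope c" "exec c s t (run c s)"
      "t' \<le> slope d" "exec d (run c s) t' (run d (run c s))"
    by fastforce
  then have "exec (Seq c d) s (1 + t + t') (run (Seq c d) s)"
    by (simp only: run.simps exec.Seq)
  then show ?case
    using \<open>t \<le> slope c\<close> \<open>t' \<le> slope d\<close> by (intro exI[of _ "1 + t + t'"]) simp
next
  case (Cond b c d)
  then obtain t t' where *: "t \<le> slope c" "exec c s t (run c s)" "t' \<le> slope d" "exec d s t' (run d s)"
    by fastforce
  let ?t = "1 + ccost b + (if cval b s then t else t')"
  have "exec (Cond b c d) s ?t (run (Cond b c d) s)"
    using * exec.CondTrue exec.CondFalse by simp
  then show ?case
    using * by (intro exI[of _ ?t]) simp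
qed (unfold run.simps slope.simps,
    (rule exI, rule conjI, rule order.refl, rule exec.intros)+, simp)

text \<open>A total-correctness triple with its time bound built in. The bound is determined by the
  syntax of \<open>c\<close> and the fixed \<open>p\<close>, so composing programs needs no
  bookkeeping of costs.\<close>

definition triple :: "nat \<Rightarrow> (state \<Rightarrow> bool) \<Rightarrow> com \<Rightarrow> (state \<Rightarrow> bool) \<Rightarrow> bool" where
  "triple p P c Q \<longleftrightarrow>
     (\<forall>s. P s \<longrightarrow> (\<exists>t s'. exec c s t s' \<and> t \<le> slope c * (p + 1) \<and> Q s'))"

lemma triple_run:
  assumes "loop_free c" "\<And>s. P s \<Longrightarrow> Q (run c s)"
  shows "triple p P c Q"
  unfolding triple_def
proof (intro allI impI)
  fix s
  assume "P s"
  obtain t where "t \<le> slope c" "exec c s t (run c s)"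
    using exec_run[OF assms(1)] by blast
  then show "\<exists>t s'. exec c s t s' \<and> t \<le> slope c * (p + 1) \<and> Q s'"
    using assms(2)[OF \<open>P s\<close>] by (metis add_leD1 distrib_left mult.right_neutral add.commute
        le_trans le_add1)
qed

lemma triple_Seq:
  assumes "triple p P c Q" "triple p Q d R"
  shows "triple p P (Seq c d) R"
  unfolding triple_def
proof (intro allI impI)
  fix s
  assume "P s"
  then obtain t s' t' s'' where *: "exec c s t s'" "t \<le> slope c * (p + 1)"
      "exec d s' t' s''" "t' \<le> slope d * (p + 1)" "R s''"
    using assms unfolding triple_def by blast
  then have "exec (Seq c d) s (1 + t + t') s''"
    by (blast intro: exec.Seq)
  moreover have "1 + t + t' \<le> slope (Seq c d) * (p + 1)"
    using * by (simp add: algebra_simps)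
  ultimately show "\<exists>t s'. exec (Seq c d) s t s' \<and> t \<le> slope (Seq c d) * (p + 1) \<and> R s'"
    using * by blast
qed

text \<open>The measure bounds the number of passes; the \<open>+ 1\<close> pays for the last,
  failing test.\<close>

lemma exec_While:
  assumes "loop_free c"
    and step: "\<And>s. I s \<Longrightarrow> cval b s \<Longrightarrow> I (run c s) \<and> m (run c s) < m s"
    and "I s"
  shows "\<exists>t s'. exec (While b c) s t s' \<and> t \<le> (1 + ccost b + slope c) * (m s + 1) \<and>
    I s' \<and> \<not> cval b s'"
  using \<open>I s\<close>
proof (induction "m s" arbitrary: s rule: less_induct)
  case less
  show ?case
  proof (cases "cval b s")
    case False
    then have "exec (While b c) s (1 + ccost b) s"
      by (rule exec.WhileFalse)
    then show ?thesis
      using False less.prems by (intro exI[of _ "1 + ccost b"] exI[of _ s]) auto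
  next
    case True
    let ?k = "1 + ccost b + slope c"
    obtain t where t: "t \<le> slope c" "exec c s t (run c s)"
      using exec_run[OF assms(1)] by blast
    have lt: "m (run c s) < m s" and "I (run c s)"
      using step less.prems True by auto
    then obtain t' s' where t': "exec (While b c) (run c s) t' s'"
        "t' \<le> ?k * (m (run c s) + 1)" "I s'" "\<not> cval b s'"
      using less.hyps by blast
    have "t' \<le> ?k * m s"
      using t'(2) mult_le_mono2[of "m (run c s) + 1" "m s" ?k] lt by linarith
    then have "1 + ccost b + t + t' \<le> ?k * (m s + 1)"
      using t(1) by simp
    moreover have "exec (While b c) s (1 + ccost b + t + t') s'"
      using exec.WhileTrue[OF True t(2) t'(1)] .
    ultimately show ?thesis
      using t' by blast
  qed
qed

lemma triple_While:
  assumes "loop_free c"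
    and "\<And>s. I s \<Longrightarrow> cval b s \<Longrightarrow> I (run c s) \<and> m (run c s) < m s"
    and "\<And>s. I s \<Longrightarrow> m s \<le> 2 * p"
    and "\<And>s. I s \<Longrightarrow> \<not> cval b s \<Longrightarrow> Q s"
  shows "triple p I (While b c) Q"
  unfolding triple_def
proof (intro allI impI)
  fix s
  assume "I s"
  then obtain t s' where *: "exec (While b c) s t s'" "t \<le> (1 + ccost b + slope c) * (m s + 1)"
      "I s'" "\<not> cval b s'"
    using exec_While[of c I b m, OF assms(1,2)] by blast
  \<comment> \<open>With at most 2p passes there are at most 2p + 1 tests, which is below 2(p + 1);
    this is the factor 2 in \<open>slope\<close> of a loop.\<close>
  have "(1 + ccost b + slope c) * (m s + 1) \<le> (1 + ccost b + slope c) * (2 * (p + 1))"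
    using assms(3)[OF \<open>I s\<close>] by (intro mult_le_mono2) simp
  then have "t \<le> slope (While b c) * (p + 1)"
    using *(2) by (simp add: algebra_simps)
  then show "\<exists>t s'. exec (While b c) s t s' \<and> t \<le> slope (While b c) * (p + 1) \<and> Q s'"
    using * assms(4) by blast
qed

section \<open>Breadth-first search\<close>

definition adjacent :: "nat \<Rightarrow> nat \<Rightarrow> edge set \<Rightarrow> nat \<Rightarrow> nat \<Rightarrow> bool" where
  "adjacent h w S i j \<longleftrightarrow> (i, j) \<in> grid_edges h w - S \<or> (j, i) \<in> grid_edges h w - S"

lemma adjacent_sym: "adjacent h w S i j \<Longrightarrow> adjacent h w S j i"
  by (auto simp: adjacent_def)

lemma adjacent_linked: "adjacent h w S i j \<Longrightarrow> linked (cut_graph h w S) i j"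
  unfolding adjacent_def by (rule linked_edge)

text \<open>
  The label 0 marks unvisited pixels; the label of a component is the pixel \<open>nx\<close> at which its search
  was started.  Positions \<open>1..<front\<close> of the queue hold the pixels already processed, positions
  \<open>front..<rear\<close> those still waiting.  That all waiting pixels carry the current label \<open>cur\<close> is what
  makes labels agree along every edge: a visited neighbour of a pixel being processed was either
  processed before (and then saw this pixel) or is waiting too.
\<close>
definition search_inv ::
    "nat \<Rightarrow> nat \<Rightarrow> edge set \<Rightarrow> (nat \<Rightarrow> nat) \<Rightarrow> (nat \<Rightarrow> nat) \<Rightarrow> nat \<Rightarrow> nat \<Rightarrow> nat \<Rightarrow> nat \<Rightarrow> bool" where
  "search_inv h w S lbl q front rear cur nx \<longleftrightarrow>
     1 \<le> front \<and> front \<le> rear \<and> 1 \<le> nx \<and> nx \<le> h * w + 1 \<and>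
     bij_betw q {1..<rear} {i \<in> pixels h w. lbl i \<noteq> 0} \<and>
     (\<forall>i\<in>pixels h w. lbl i \<noteq> 0 \<longrightarrow> linked (cut_graph h w S) (lbl i) i) \<and>
     (\<forall>k\<in>{front..<rear}. lbl (q k) = cur) \<and>
     (\<forall>k\<in>{1..<front}. \<forall>j. adjacent h w S (q k) j \<longrightarrow> lbl j = lbl (q k)) \<and>
     (\<forall>k\<in>{1..<nx}. lbl k \<noteq> 0)"

text \<open>The queue positions are in bijection with visited pixels, so no pixel is queued twice.
  This limits the number of passes of the search.\<close>

lemma search_inv_tail_le:
  assumes "search_inv h w S lbl q front rear cur nx"
  shows "rear \<le> h * w + 1"
proof -
  have "card {1..<rear} = card {i \<in> pixels h w. lbl i \<noteq> 0}"
    using assms bij_betw_same_card unfolding search_inv_def by blast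
  also have "\<dots> \<le> card (pixels h w)"
    by (rule card_mono) auto
  finally show ?thesis
    by (simp add: pixels_def)
qed

lemma search_inv_queue:
  assumes "search_inv h w S lbl q front rear cur nx" "1 \<le> k" "k < rear"
  shows "q k \<in> pixels h w" "lbl (q k) \<noteq> 0"
  using assms bij_betwE[of q "{1..<rear}"] unfolding search_inv_def by fastforce+

lemma search_inv_visit:
  assumes inv: "search_inv h w S lbl q front rear cur nx"
    and "lbl y = 0" and cur: "linked (cut_graph h w S) cur y"
  shows "search_inv h w S (lbl(y := cur)) (q(rear := y)) front (rear + 1) cur nx"
proof -
  have y: "y \<in> pixels h w" and "cur \<noteq> 0"
    using linked_simps(2,3)[OF cur] by (auto simp: pixels_def)
  have q: "q k \<noteq> y" if "1 \<le> k" "k < rear" for k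
    using search_inv_queue[OF inv that] \<open>lbl y = 0\<close> by auto
  have "bij_betw q {1..<rear} {i \<in> pixels h w. lbl i \<noteq> 0}"
    using inv by (simp add: search_inv_def)
  then have "bij_betw (q(rear := y)) {1..<rear} {i \<in> pixels h w. lbl i \<noteq> 0}"
    by (rule bij_betw_cong[THEN iffD1, rotated]) auto
  then have "bij_betw (q(rear := y)) ({1..<rear} \<union> {rear}) ({i \<in> pixels h w. lbl i \<noteq> 0} \<union> {y})"
    using \<open>lbl y = 0\<close> notIn_Un_bij_betw[of rear "{1..<rear}" "q(rear := y)"] by simp
  moreover have "{1..<rear} \<union> {rear} = {1..<rear + 1}"
    using inv by (auto simp: search_inv_def)
  moreover have "{i \<in> pixels h w. lbl i \<noteq> 0} \<union> {y} = {i \<in> pixels h w. (lbl(y := cur)) i \<noteq> 0}"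
    using y \<open>cur \<noteq> 0\<close> by auto
  \<comment> \<open>Neighbours of an already processed pixel carry its nonzero label, so
    \<open>y\<close> is not among them and the new label disturbs none of these equalities.\<close>
  moreover have "(lbl(y := cur)) j = (lbl(y := cur)) ((q(rear := y)) k)"
    if k: "k \<in> {1..<front}" and j: "adjacent h w S ((q(rear := y)) k) j" for k j
  proof -
    have "1 \<le> k" "k < rear"
      using k inv by (auto simp: search_inv_def)
    then have "lbl j = lbl (q k)" "lbl (q k) \<noteq> 0"
      using inv j k search_inv_queue(2)[OF inv] by (auto simp: search_inv_def)
    then show ?thesis
      using \<open>lbl y = 0\<close> \<open>k < rear\<close> by auto
  qed
  ultimately show ?thesis
    using inv cur \<open>cur \<noteq> 0\<close> q unfolding search_inv_def by auto
qed

lemma search_inv_dequeue: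
  assumes inv: "search_inv h w S lbl q front rear cur nx" and "front < rear"
    and visited: "\<And>y. adjacent h w S (q front) y \<Longrightarrow> lbl y \<noteq> 0"
  shows "search_inv h w S lbl q (front + 1) rear cur nx"
proof -
  have "lbl y = lbl (q front)" if y: "adjacent h w S (q front) y" for y
  proof -
    have "y \<in> pixels h w"
      using linked_simps(3)[OF adjacent_linked[OF y]] .
    then have "y \<in> q ` {1..<rear}"
      using visited[OF y] inv by (auto simp: search_inv_def bij_betw_def)
    then obtain k where k: "1 \<le> k" "k < rear" "y = q k"
      by auto
    show ?thesis
    proof (cases "k < front")
      case True
      then show ?thesis
        using inv k adjacent_sym[OF y] by (auto simp: search_inv_def)
    next
      case False
      then show ?thesis
        using inv k \<open>front < rear\<close> by (auto simp: search_inv_def)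
    qed
  qed
  then show ?thesis
    using inv \<open>front < rear\<close> unfolding search_inv_def by (auto simp: less_Suc_eq)
qed

lemma search_inv_next:
  assumes "search_inv h w S lbl q front rear cur nx" "lbl nx \<noteq> 0" "nx \<le> h * w"
  shows "search_inv h w S lbl q front rear cur (nx + 1)"
  using assms unfolding search_inv_def by (auto simp: less_Suc_eq)

text \<open>\<open>cur\<close> constrains only waiting positions, so with none left the next search
  may use a fresh label.\<close>

lemma search_inv_empty_queue:
  assumes "search_inv h w S lbl q front rear cur nx" "\<not> front < rear"
  shows "search_inv h w S lbl q front rear cur' nx"
  using assms unfolding search_inv_def by auto

text \<open>Each label is a pixel linked to the pixels that carry it, so equal labels imply linked.
  Conversely, every pixel has been processed, so labels agree along edges and therefore along
  walks.\<close>

lemma search_inv_final: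
  assumes inv: "search_inv h w S lbl q front rear cur nx"
    and "\<not> front < rear" "\<not> nx < h * w + 1" "i \<in> pixels h w"
  shows "lbl i \<in> pixels h w"
    and "j \<in> pixels h w \<Longrightarrow> lbl i = lbl j \<longleftrightarrow> linked (cut_graph h w S) i j"
proof -
  have nz: "lbl k \<noteq> 0" if "k \<in> pixels h w" for k
    using that assms by (auto simp: search_inv_def pixels_def)
  have link: "linked (cut_graph h w S) (lbl k) k" if "k \<in> pixels h w" for k
    using that nz[OF that] inv by (auto simp: search_inv_def)
  show "lbl i \<in> pixels h w"
    using linked_simps(2)[OF link] assms by auto
  assume j: "j \<in> pixels h w"
  show "lbl i = lbl j \<longleftrightarrow> linked (cut_graph h w S) i j"
  proof
    assume "lbl i = lbl j"
    then show "linked (cut_graph h w S) i j"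
      using link[OF assms(4)] link[OF j] linked_simps(1) linked_sym by metis
  next
    have edge: "lbl x = lbl y" if "adjacent h w S x y" for x y
    proof -
      have "x \<in> pixels h w"
        using linked_simps(2)[OF adjacent_linked[OF that]] .
      then have "x \<in> q ` {1..<front}"
        using nz inv assms(2) by (auto simp: search_inv_def bij_betw_def)
      then show ?thesis
        using that inv by (auto simp: search_inv_def)
    qed
    assume "linked (cut_graph h w S) i j"
    then show "lbl i = lbl j"
      by (induction rule: linked_induct) (use edge in \<open>auto simp: adjacent_def\<close>)
  qed
qed

section \<open>Adjacency in the pixel grid\<close>

lemma mem_pixels: "i \<in> pixels h w \<longleftrightarrow> 1 \<le> i \<and> i \<le> h * w"
  by (auto simp: pixels_def)

lemma pixel_eqI:
  assumes "1 \<le> i" "1 \<le> j" "pixel_row w i = pixel_row w j" "pixel_col w j = pixel_col w i + k"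
  shows "j = i + k"
proof -
  have "j - 1 = i - 1 + k"
    using div_mult_mod_eq[of "i - 1" w] div_mult_mod_eq[of "j - 1" w] assms(3,4)
    unfolding pixel_row_def pixel_col_def by (metis add.assoc)
  then show ?thesis
    using assms(1,2) by linarith
qed

lemma right_pixel:
  assumes "i \<in> pixels h w" "pixel_col w i + 1 < w"
  shows "i + 1 \<in> pixels h w" "pixel_row w (i + 1) = pixel_row w i"
    "pixel_col w (i + 1) = pixel_col w i + 1"
proof -
  obtain k where k: "i = Suc k" "k < h * w"
    using assms(1) by (cases i) (auto simp: mem_pixels)
  have m: "Suc (k mod w) < w"
    using assms(2) k by (simp add: pixel_col_def)
  then have "Suc k mod w = Suc (k mod w)"
    by (simp add: mod_Suc)
  moreover from this have "Suc k div w = k div w"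
    by (simp add: div_Suc)
  ultimately show "pixel_row w (i + 1) = pixel_row w i" "pixel_col w (i + 1) = pixel_col w i + 1"
    using k by (simp_all add: pixel_row_def pixel_col_def)
  \<comment> \<open>The row of \<open>k\<close> ends at address \<open>(k div w + 1) * w\<close>, at
    most \<open>h * w\<close>; a step to the right inside the row therefore stays in the
    image.\<close>
  have "k div w < h"
    using k(2) by (simp add: less_mult_imp_div_less)
  then have "k div w * w + w \<le> h * w"
    by (metis Suc_leI mult_Suc mult_le_mono1 add.commute)
  then have "k + 1 < h * w"
    using m div_mult_mod_eq[of k w] by linarith
  then show "i + 1 \<in> pixels h w"
    using k by (simp add: mem_pixels)
qed

lemma down_pixel:
  assumes "1 \<le> i" "1 \<le> w"
  shows "pixel_row w (i + w) = pixel_row w i + 1" "pixel_col w (i + w) = pixel_col w i"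
  using assms by (cases i; simp add: pixel_row_def pixel_col_def)+

text \<open>Rows are consecutive blocks of length \<open>w\<close>, so neighbours sit at offsets 1
  and \<open>w\<close>, which the machine can compute. A step down leaves the image only by passing
  \<open>h * w\<close>; a step right needs the column, to avoid wrapping into the next row.\<close>

lemma grid_edges_iff:
  assumes "1 \<le> w"
  shows "(i, j) \<in> grid_edges h w \<longleftrightarrow> i \<in> pixels h w \<and>
    (j = i + 1 \<and> pixel_col w i + 1 < w \<or> j = i + w \<and> j \<le> h * w)"
proof
  assume e: "(i, j) \<in> grid_edges h w"
  then have ij: "i \<in> pixels h w" "j \<in> pixels h w"
    using grid_edges_in_pixels by auto
  have cj: "pixel_col w j < w"
    using assms by (simp add: pixel_col_def)
  consider "pixel_row w i = pixel_row w j" "pixel_col w j = pixel_col w i + 1"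
    | "pixel_col w i = pixel_col w j" "pixel_row w j = pixel_row w i + 1"
    using e by (auto simp: grid_edges_def)
  then show "i \<in> pixels h w \<and>
    (j = i + 1 \<and> pixel_col w i + 1 < w \<or> j = i + w \<and> j \<le> h * w)"
  proof cases
    case 1
    then show ?thesis
      using pixel_eqI[of i j w 1] ij cj by (auto simp: mem_pixels)
  next
    case 2
    then have "j = i + w + 0"
      using ij assms by - (rule pixel_eqI[where w = w], simp_all add: down_pixel mem_pixels)
    then show ?thesis
      using ij by (auto simp: mem_pixels)
  qed
next
  assume "i \<in> pixels h w \<and>
    (j = i + 1 \<and> pixel_col w i + 1 < w \<or> j = i + w \<and> j \<le> h * w)"
  then show "(i, j) \<in> grid_edges h w"
    using right_pixel[of i h w] down_pixel[of i w] assms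
    by (auto simp: grid_edges_def mem_pixels)
qed

lemma input_right:
  assumes "is_input h w u S s" "1 \<le> w" "i \<in> pixels h w" "pixel_col w i + 1 < w"
  shows "iarr s ''right'' i = of_bool ((i, i + 1) \<in> S)"
proof -
  have "(i, i + 1) \<in> grid_edges h w"
    using assms by (simp add: grid_edges_iff)
  then show ?thesis
    using assms(1) right_pixel[OF assms(3,4)] by (fastforce simp: is_input_def)
qed

lemma input_down:
  assumes "is_input h w u S s" "1 \<le> w" "i \<in> pixels h w" "i + w \<le> h * w"
  shows "iarr s ''down'' i = of_bool ((i, i + w) \<in> S)"
proof -
  have "(i, i + w) \<in> grid_edges h w"
    using assms by (simp add: grid_edges_iff)
  then show ?thesis
    using assms down_pixel[of i w] by (fastforce simp: is_input_def mem_pixels)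
qed

text \<open>
  The entries at index 0 are sentinels: with truncated subtraction, \<open>r (x - 1)\<close> and \<open>d (x - w)\<close> are
  then correct tests for an edge from \<open>x\<close> to the left or upwards, without any bounds check.
\<close>
definition edges_stored ::
    "nat \<Rightarrow> nat \<Rightarrow> edge set \<Rightarrow> (nat \<Rightarrow> nat) \<Rightarrow> (nat \<Rightarrow> nat) \<Rightarrow> nat \<Rightarrow> bool" where
  "edges_stored h w S r d n \<longleftrightarrow> r 0 = 0 \<and> d 0 = 0 \<and>
     (\<forall>j\<in>{1..<n}. r j = of_bool (pixel_col w j + 1 < w \<and> (j, j + 1) \<notin> S) \<and>
       d j = of_bool (j + w \<le> h * w \<and> (j, j + w) \<notin> S))"

lemma adjacent_iff:
  assumes st: "edges_stored h w S r d (h * w + 1)" and w: "1 \<le> w" and x: "x \<in> pixels h w"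
  shows "adjacent h w S x y \<longleftrightarrow>
    r x = 1 \<and> y = x + 1 \<or> r (x - 1) = 1 \<and> y = x - 1 \<or>
    d x = 1 \<and> y = x + w \<or> d (x - w) = 1 \<and> y = x - w"
proof -
  have out: "(i, j) \<in> grid_edges h w - S \<longleftrightarrow> r i = 1 \<and> j = i + 1 \<or> d i = 1 \<and> j = i + w"
    if "i = 0 \<or> i \<in> pixels h w" for i j
    using that st w by (cases "i = 0") (auto simp: edges_stored_def grid_edges_iff mem_pixels)
  have "y \<in> pixels h w" if "(y, x) \<in> grid_edges h w"
    using that grid_edges_in_pixels by auto
  then have "(y, x) \<in> grid_edges h w - S \<longleftrightarrow>
      (y = 0 \<or> y \<in> pixels h w) \<and> (r y = 1 \<and> x = y + 1 \<or> d y = 1 \<and> x = y + w)"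
    using out by blast
  \<comment> \<open>A flag equal to 1 excludes index 0, so in these cases the truncated subtraction
    is exact and can be inverted.\<close>
  also have "\<dots> \<longleftrightarrow> r (x - 1) = 1 \<and> y = x - 1 \<or> d (x - w) = 1 \<and> y = x - w"
    using x st by (auto simp: mem_pixels edges_stored_def Suc_le_eq)
  finally show ?thesis
    using out x by (auto simp: adjacent_def)
qed

section \<open>The program\<close>

abbreviation Inc :: "vname \<Rightarrow> com" where
  "Inc x \<equiv> SetIVar x (IPlus (IVar x) (IConst 1))"

abbreviation For_pixels :: "com \<Rightarrow> com" where
  "For_pixels c \<equiv> While (Less (IVar ''i'') (IPlus (IVar ''p'') (IConst 1))) (Seq c (Inc ''i''))"

text \<open>The machine cannot multiply naturals, so \<open>w\<close> is added \<open>h\<close>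
  times. As \<open>w\<close> is at least 1, these \<open>h\<close> passes are within the linear
  budget.\<close>

definition count_pixels :: com where
  "count_pixels =
    Seq (Seq (SetIVar ''p'' (IConst 0)) (SetIVar ''i'' (IConst 0)))
      (While (Less (IVar ''i'') (IVar ''h''))
        (Seq (SetIVar ''p'' (IPlus (IVar ''p'') (IVar ''w''))) (Inc ''i'')))"

lemma count_pixels_correct:
  assumes "1 \<le> w"
  shows "triple (h * w) (is_input h w u S) count_pixels
    (\<lambda>s. is_input h w u S s \<and> ivar s ''p'' = h * w)"
  unfolding count_pixels_def
proof (rule triple_Seq)
  let ?I = "\<lambda>s. is_input h w u S s \<and> ivar s ''i'' \<le> h \<and> ivar s ''p'' = ivar s ''i'' * w"
  show "triple (h * w) (is_input h w u S)
      (Seq (SetIVar ''p'' (IConst 0)) (SetIVar ''i'' (IConst 0))) ?I"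
    by (rule triple_run) (auto simp: is_input_def)
  have "h \<le> h * w"
    using assms by simp
  then have *: "h - k \<le> 2 * (h * w)" for k
    by linarith
  show "triple (h * w) ?I
      (While (Less (IVar ''i'') (IVar ''h''))
        (Seq (SetIVar ''p'' (IPlus (IVar ''p'') (IVar ''w''))) (Inc ''i'')))
      (\<lambda>s. is_input h w u S s \<and> ivar s ''p'' = h * w)"
    by (intro triple_While[where m = "\<lambda>s. h - ivar s ''i''"]) (simp_all add: is_input_def *)
qed

text \<open>The invariant may mention the counter \<open>i\<close>, read as the first pixel not yet
  treated. That the body leaves \<open>i\<close> alone gives the decrease of
  \<open>p + 1 - i\<close>.\<close>

lemma triple_For_pixels:
  assumes "loop_free c"
    and "\<And>s. P s \<Longrightarrow> I (s\<lparr>ivar := (ivar s)(''i'' := 1)\<rparr>)"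
    and "\<And>s. I s \<Longrightarrow> ivar s ''p'' = p \<and> 1 \<le> ivar s ''i'' \<and> ivar s ''i'' \<le> p + 1"
    and "\<And>s. I s \<Longrightarrow> ivar s ''i'' \<in> {1..p} \<Longrightarrow>
      I (run (Inc ''i'') (run c s)) \<and> ivar (run c s) ''i'' = ivar s ''i''"
    and "\<And>s. I s \<Longrightarrow> ivar s ''i'' = p + 1 \<Longrightarrow> Q s"
  shows "triple p P (Seq (SetIVar ''i'' (IConst 1)) (For_pixels c)) Q"
proof (rule triple_Seq)
  show "triple p P (SetIVar ''i'' (IConst 1)) I"
    by (rule triple_run) (use assms(2) in auto)
  show "triple p I (For_pixels c) Q"
  proof (rule triple_While[where m = "\<lambda>s. p + 1 - ivar s ''i''"])
    fix s
    assume s: "I s" "cval (Less (IVar ''i'') (IPlus (IVar ''p'') (IConst 1))) s"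
    then have "ivar s ''i'' \<in> {1..p}"
      using assms(3)[OF s(1)] by simp
    then show "I (run (Seq c (Inc ''i'')) s) \<and>
        p + 1 - ivar (run (Seq c (Inc ''i'')) s) ''i'' < p + 1 - ivar s ''i''"
      using assms(4)[OF s(1)] by auto
  next
    fix s
    assume "I s" "\<not> cval (Less (IVar ''i'') (IPlus (IVar ''p'') (IConst 1))) s"
    then show "Q s"
      using assms(3)[of s] by (intro assms(5)) auto
  next
    fix s
    assume "I s"
    then show "p + 1 - ivar s ''i'' \<le> 2 * p"
      using assms(3)[of s] by auto
  qed (use assms(1) in simp)
qed

text \<open>A frame rule: the input survives every update that avoids the five names it
  occupies.\<close>

lemma is_input_cong:
  assumes "is_input h w u S s" "ivar s' ''h'' = ivar s ''h''" "ivar s' ''w'' = ivar s ''w''"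
    "rarr s' ''u'' = rarr s ''u''" "iarr s' ''right'' = iarr s ''right''"
    "iarr s' ''down'' = iarr s ''down''"
  shows "is_input h w u S s'"
proof -
  have "iarr s' (if b then ''right'' else ''down'') = iarr s (if b then ''right'' else ''down'')" for b
    using assms by simp
  then show ?thesis
    using assms by (simp only: is_input_def simp_thms) blast
qed

section \<open>Clearing the memory and storing the edges of the cut graph\<close>

abbreviation store_flag :: "vname \<Rightarrow> iexp \<Rightarrow> cond \<Rightarrow> com" where
  "store_flag a e b \<equiv> Cond b (SetIArr a e (IConst 1)) (SetIArr a e (IConst 0))"

text \<open>Reading the conditional as one update keeps the symbolic execution of
  \<open>prepare_pixel\<close> free of case splits.\<close>

lemma run_store_flag:
  "run (store_flag a e b) s =
     s\<lparr>iarr := (iarr s)(a := (iarr s a)(ival e s := of_bool (cval b s)))\<rparr>"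
  by simp

text \<open>A cyclic counter replaces the remainder modulo \<open>w\<close>, which the machine does
  not offer.\<close>

definition next_column :: com where
  "next_column =
    Seq (Inc ''col'') (Cond (Equal (IVar ''col'') (IVar ''w'')) (SetIVar ''col'' (IConst 0)) Skip)"

lemma run_next_column:
  "run next_column s = s\<lparr>ivar := (ivar s)(''col'' :=
     if ivar s ''col'' + 1 = ivar s ''w'' then 0 else ivar s ''col'' + 1)\<rparr>"
  by (simp add: next_column_def)

text \<open>The flags are inverted against the input: 1 means that the edge exists and is not cut.
  Folding the border tests into them makes the search independent of the arbitrary contents of
  \<open>right\<close> and \<open>down\<close> at the image border.\<close>

definition prepare_pixel :: com where
  "prepare_pixel =
    Seq (SetIArr ''component'' (IVar ''i'') (IConst 0))
    (Seq (SetRArr ''sum'' (IVar ''i'') RZero)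
    (Seq (SetRArr ''count'' (IVar ''i'') RZero)
    (Seq (store_flag ''r'' (IVar ''i'')
       (Conj (Less (IPlus (IVar ''col'') (IConst 1)) (IVar ''w''))
         (Equal (IArr ''right'' (IVar ''i'')) (IConst 0))))
    (Seq (store_flag ''d'' (IVar ''i'')
       (Conj (Less (IPlus (IVar ''i'') (IVar ''w'')) (IPlus (IVar ''p'') (IConst 1)))
         (Equal (IArr ''down'' (IVar ''i'')) (IConst 0))))
    next_column))))"

definition prepare :: com where
  "prepare =
    Seq (Seq (SetIArr ''r'' (IConst 0) (IConst 0))
      (Seq (SetIArr ''d'' (IConst 0) (IConst 0)) (SetIVar ''col'' (IConst 0))))
    (Seq (SetIVar ''i'' (IConst 1)) (For_pixels prepare_pixel))"

lemma run_prepare_pixel: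
  "run prepare_pixel s = s
    \<lparr>ivar := (ivar s)(''col'' := if ivar s ''col'' + 1 = ivar s ''w'' then 0 else ivar s ''col'' + 1),
     iarr := (iarr s)
       (''component'' := (iarr s ''component'')(ivar s ''i'' := 0),
        ''r'' := (iarr s ''r'')(ivar s ''i'' :=
           of_bool (ivar s ''col'' + 1 < ivar s ''w'' \<and> iarr s ''right'' (ivar s ''i'') = 0)),
        ''d'' := (iarr s ''d'')(ivar s ''i'' :=
           of_bool (ivar s ''i'' + ivar s ''w'' \<le> ivar s ''p'' \<and> iarr s ''down'' (ivar s ''i'') = 0))),
     rarr := (rarr s)
       (''sum'' := (rarr s ''sum'')(ivar s ''i'' := 0),
        ''count'' := (rarr s ''count'')(ivar s ''i'' := 0))\<rparr>"
  unfolding prepare_pixel_def run.simps(6) run_store_flag run_next_column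
  by (simp add: less_Suc_eq_le)

definition cleared :: "nat \<Rightarrow> state \<Rightarrow> bool" where
  "cleared n s \<longleftrightarrow> (\<forall>j\<in>{1..<n}.
     iarr s ''component'' j = 0 \<and> rarr s ''sum'' j = 0 \<and> rarr s ''count'' j = 0)"

definition prepared :: "nat \<Rightarrow> nat \<Rightarrow> (nat \<Rightarrow> real) \<Rightarrow> edge set \<Rightarrow> nat \<Rightarrow> state \<Rightarrow> bool" where
  "prepared h w u S n s \<longleftrightarrow> is_input h w u S s \<and> ivar s ''p'' = h * w \<and>
     edges_stored h w S (iarr s ''r'') (iarr s ''d'') n \<and> cleared n s"

lemma edges_stored_step:
  assumes "edges_stored h w S r d n" "1 \<le> n"
  shows "edges_stored h w S
    (r(n := of_bool (pixel_col w n + 1 < w \<and> (n, n + 1) \<notin> S)))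
    (d(n := of_bool (n + w \<le> h * w \<and> (n, n + w) \<notin> S))) (n + 1)"
  using assms by (auto simp: edges_stored_def less_Suc_eq)

lemma pixel_col_next:
  assumes "1 \<le> i"
  shows "pixel_col w (i + 1) = (if pixel_col w i + 1 = w then 0 else pixel_col w i + 1)"
  using assms by (cases i) (simp_all add: pixel_col_def mod_Suc)

lemma prepared_step:
  assumes w: "1 \<le> w" and pre: "prepared h w u S (ivar s ''i'') s"
    and i: "ivar s ''i'' \<in> {1..h * w}" and col: "ivar s ''col'' = pixel_col w (ivar s ''i'')"
  shows "prepared h w u S (ivar s ''i'' + 1) (run (Inc ''i'') (run prepare_pixel s))"
    and "ivar (run prepare_pixel s) ''col'' = pixel_col w (ivar s ''i'' + 1)"
    and "ivar (run prepare_pixel s) ''i'' = ivar s ''i''"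
proof -
  let ?i = "ivar s ''i''"
  have inp: "is_input h w u S s" and p: "ivar s ''p'' = h * w" and sw: "ivar s ''w'' = w"
    using pre by (simp_all add: prepared_def is_input_def)
  have pix: "?i \<in> pixels h w"
    using i by (simp add: mem_pixels)
  \<comment> \<open>In the last column both sides are false, whatever \<open>right\<close> holds
    there.\<close>
  have r: "ivar s ''col'' + 1 < ivar s ''w'' \<and> iarr s ''right'' ?i = 0 \<longleftrightarrow>
      pixel_col w ?i + 1 < w \<and> (?i, ?i + 1) \<notin> S"
    using input_right[OF inp w pix] by (auto simp: sw col)
  have d: "?i + ivar s ''w'' \<le> ivar s ''p'' \<and> iarr s ''down'' ?i = 0 \<longleftrightarrow>
      ?i + w \<le> h * w \<and> (?i, ?i + w) \<notin> S"
    using input_down[OF inp w pix] by (auto simp: sw p)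
  let ?s = "run (Inc ''i'') (run prepare_pixel s)"
  have "is_input h w u S ?s"
    by (rule is_input_cong[OF inp]) (simp_all add: run_prepare_pixel)
  moreover have "edges_stored h w S (iarr ?s ''r'') (iarr ?s ''d'') (?i + 1)"
    using edges_stored_step[of h w S "iarr s ''r''" "iarr s ''d''" ?i] pre i
    unfolding run_prepare_pixel r d by (simp add: prepared_def)
  moreover have "cleared (?i + 1) ?s"
    using pre unfolding run_prepare_pixel by (auto simp: prepared_def cleared_def less_Suc_eq)
  moreover have "ivar ?s ''p'' = h * w"
    using p by (simp add: run_prepare_pixel)
  ultimately show "prepared h w u S (?i + 1) ?s"
    by (simp add: prepared_def)
  show "ivar (run prepare_pixel s) ''col'' = pixel_col w (?i + 1)"
    unfolding run_prepare_pixel using pixel_col_next[of ?i w] i by (simp add: col sw)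
  show "ivar (run prepare_pixel s) ''i'' = ?i"
    by (simp add: run_prepare_pixel)
qed

lemma prepare_correct:
  assumes "1 \<le> w"
  shows "triple (h * w) (\<lambda>s. is_input h w u S s \<and> ivar s ''p'' = h * w) prepare
    (prepared h w u S (h * w + 1))"
  unfolding prepare_def
proof (rule triple_Seq)
  let ?P = "\<lambda>s. prepared h w u S 1 s \<and> ivar s ''col'' = 0"
  show "triple (h * w) (\<lambda>s. is_input h w u S s \<and> ivar s ''p'' = h * w)
    (Seq (SetIArr ''r'' (IConst 0) (IConst 0))
      (Seq (SetIArr ''d'' (IConst 0) (IConst 0)) (SetIVar ''col'' (IConst 0)))) ?P"
    by (rule triple_run)
      (auto simp: prepared_def edges_stored_def cleared_def elim: is_input_cong)
  show "triple (h * w) ?P (Seq (SetIVar ''i'' (IConst 1)) (For_pixels prepare_pixel))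
     (prepared h w u S (h * w + 1))"
  proof (rule triple_For_pixels[where I = "\<lambda>s. prepared h w u S (ivar s ''i'') s \<and>
        ivar s ''col'' = pixel_col w (ivar s ''i'') \<and> 1 \<le> ivar s ''i'' \<and> ivar s ''i'' \<le> h * w + 1"])
    fix s
    assume "?P s"
    then show "prepared h w u S (ivar (s\<lparr>ivar := (ivar s)(''i'' := 1)\<rparr>) ''i'')
          (s\<lparr>ivar := (ivar s)(''i'' := 1)\<rparr>) \<and>
        ivar (s\<lparr>ivar := (ivar s)(''i'' := 1)\<rparr>) ''col'' =
          pixel_col w (ivar (s\<lparr>ivar := (ivar s)(''i'' := 1)\<rparr>) ''i'') \<and>
        1 \<le> ivar (s\<lparr>ivar := (ivar s)(''i'' := 1)\<rparr>) ''i'' \<and>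
        ivar (s\<lparr>ivar := (ivar s)(''i'' := 1)\<rparr>) ''i'' \<le> h * w + 1"
      by (auto simp: prepared_def cleared_def pixel_col_def elim: is_input_cong)
  next
    show "loop_free prepare_pixel"
      by (simp add: prepare_pixel_def next_column_def)
  next
    fix s
    assume s: "prepared h w u S (ivar s ''i'') s \<and>
      ivar s ''col'' = pixel_col w (ivar s ''i'') \<and> 1 \<le> ivar s ''i'' \<and> ivar s ''i'' \<le> h * w + 1"
      and i: "ivar s ''i'' \<in> {1..h * w}"
    have *: "ivar (run (Inc ''i'') t) ''i'' = ivar t ''i'' + 1"
        "ivar (run (Inc ''i'') t) ''col'' = ivar t ''col''" for t
      by simp_all
    show "(prepared h w u S (ivar (run (Inc ''i'') (run prepare_pixel s)) ''i'')
          (run (Inc ''i'') (run prepare_pixel s)) \<and>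
        ivar (run (Inc ''i'') (run prepare_pixel s)) ''col'' =
          pixel_col w (ivar (run (Inc ''i'') (run prepare_pixel s)) ''i'') \<and>
        1 \<le> ivar (run (Inc ''i'') (run prepare_pixel s)) ''i'' \<and>
        ivar (run (Inc ''i'') (run prepare_pixel s)) ''i'' \<le> h * w + 1) \<and>
      ivar (run prepare_pixel s) ''i'' = ivar s ''i''"
      unfolding * using prepared_step[OF assms, of h u S s] s i by simp
  qed (auto simp: prepared_def)
qed

section \<open>The search loop and its invariant\<close>

definition visit :: "cond \<Rightarrow> iexp \<Rightarrow> com" where
  "visit b e = Cond (Conj b (Equal (IArr ''component'' e) (IConst 0)))
    (Seq (SetIArr ''component'' e (IVar ''label''))
      (Seq (SetIArr ''queue'' (IVar ''tail'') e) (Inc ''tail'')))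
    Skip"

definition visit_neighbours :: com where
  "visit_neighbours =
    Seq (visit (Equal (IArr ''r'' (IVar ''x'')) (IConst 1)) (IPlus (IVar ''x'') (IConst 1)))
    (Seq (visit (Equal (IArr ''r'' (IMinus (IVar ''x'') (IConst 1))) (IConst 1))
      (IMinus (IVar ''x'') (IConst 1)))
    (Seq (visit (Equal (IArr ''d'' (IVar ''x'')) (IConst 1)) (IPlus (IVar ''x'') (IVar ''w'')))
    (visit (Equal (IArr ''d'' (IMinus (IVar ''x'') (IVar ''w''))) (IConst 1))
      (IMinus (IVar ''x'') (IVar ''w'')))))"

text \<open>
  Each pass either processes a queued pixel or, if the queue is empty, advances the scan for an
  unvisited starting pixel; so \<open>head + i\<close> grows by one and there are at most \<open>2 * p\<close> passes.
\<close>
definition search_step :: com where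
  "search_step = Cond (Less (IVar ''head'') (IVar ''tail''))
    (Seq (SetIVar ''x'' (IArr ''queue'' (IVar ''head''))) (Seq visit_neighbours (Inc ''head'')))
    (Seq (SetIVar ''label'' (IVar ''i''))
      (Seq (visit (Equal (IConst 0) (IConst 0)) (IVar ''i'')) (Inc ''i'')))"

text \<open>The guard is a disjunction written by De Morgan, as conditions have only
  \<open>Neg\<close> and \<open>Conj\<close>. \<open>label\<close> starts with an arbitrary value,
  harmless while the queue is empty.\<close>

definition search :: com where
  "search =
    Seq (Seq (SetIVar ''i'' (IConst 1))
      (Seq (SetIVar ''head'' (IConst 1)) (SetIVar ''tail'' (IConst 1))))
    (While (Neg (Conj (Neg (Less (IVar ''head'') (IVar ''tail'')))
        (Neg (Less (IVar ''i'') (IPlus (IVar ''p'') (IConst 1))))))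
      search_step)"

definition searching :: "nat \<Rightarrow> nat \<Rightarrow> (nat \<Rightarrow> real) \<Rightarrow> edge set \<Rightarrow> state \<Rightarrow> bool" where
  "searching h w u S s \<longleftrightarrow> is_input h w u S s \<and> ivar s ''p'' = h * w \<and>
     edges_stored h w S (iarr s ''r'') (iarr s ''d'') (h * w + 1) \<and>
     (\<forall>j\<in>pixels h w. rarr s ''sum'' j = 0 \<and> rarr s ''count'' j = 0) \<and>
     search_inv h w S (iarr s ''component'') (iarr s ''queue'')
       (ivar s ''head'') (ivar s ''tail'') (ivar s ''label'') (ivar s ''i'')"

text \<open>What survives a sequence of visits: tests and addresses computed from \<open>x\<close>
  keep their values, queued entries stay in place, and a labelled pixel keeps its label.\<close>

definition extends :: "state \<Rightarrow> state \<Rightarrow> bool" where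
  "extends s s' \<longleftrightarrow> (\<forall>x. x \<noteq> ''tail'' \<longrightarrow> ivar s' x = ivar s x) \<and>
     ivar s ''tail'' \<le> ivar s' ''tail'' \<and>
     (\<forall>a. a \<noteq> ''component'' \<longrightarrow> a \<noteq> ''queue'' \<longrightarrow> iarr s' a = iarr s a) \<and>
     (\<forall>k<ivar s ''tail''. iarr s' ''queue'' k = iarr s ''queue'' k) \<and>
     (\<forall>y. iarr s ''component'' y \<noteq> 0 \<longrightarrow> iarr s' ''component'' y = iarr s ''component'' y)"

lemma extends_refl: "extends s s"
  by (simp add: extends_def)

lemma extends_trans: "extends s s' \<Longrightarrow> extends s' s'' \<Longrightarrow> extends s s''"
  by (auto simp: extends_def)

text \<open>The program evaluates \<open>e\<close> a second time after writing to
  \<open>component\<close>; the last hypothesis guarantees that the same pixel is labelled and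
  queued.\<close>

lemma visit_correct:
  assumes inv: "searching h w u S s"
    and link: "cval b s \<Longrightarrow> linked (cut_graph h w S) (ivar s ''label'') (ival e s)"
    and e: "\<And>f. ival e (s\<lparr>iarr := f\<rparr>) = ival e s"
  shows "searching h w u S (run (visit b e) s)"
    and "extends s (run (visit b e) s)"
    and "cval b s \<Longrightarrow> iarr (run (visit b e) s) ''component'' (ival e s) \<noteq> 0"
proof -
  let ?y = "ival e s" and ?s = "run (visit b e) s"
  have "searching h w u S ?s \<and> extends s ?s \<and>
    (cval b s \<longrightarrow> iarr ?s ''component'' ?y \<noteq> 0)"
  proof (cases "cval b s \<and> iarr s ''component'' ?y = 0")
    case False
    then have "?s = s"
      by (auto simp: visit_def)
    then show ?thesis
      using inv False by (auto simp: extends_refl)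
  next
    case True
    let ?t = "s\<lparr>ivar := (ivar s)(''tail'' := ivar s ''tail'' + 1),
      iarr := (iarr s)(''component'' := (iarr s ''component'')(?y := ivar s ''label''),
        ''queue'' := (iarr s ''queue'')(ivar s ''tail'' := ?y))\<rparr>"
    have s: "?s = ?t"
      using True by (simp add: visit_def e)
    have y: "linked (cut_graph h w S) (ivar s ''label'') ?y"
      using link True by simp
    then have "ivar s ''label'' \<noteq> 0"
      using linked_simps(2) by (fastforce simp: mem_pixels)
    have "is_input h w u S ?t"
      by (rule is_input_cong[of h w u S s]) (use inv in \<open>simp_all add: searching_def\<close>)
    moreover have "search_inv h w S (iarr ?t ''component'') (iarr ?t ''queue'')
       (ivar ?t ''head'') (ivar ?t ''tail'') (ivar ?t ''label'') (ivar ?t ''i'')"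
      using search_inv_visit[OF _ _ y] inv True by (simp add: searching_def)
    ultimately have "searching h w u S ?t"
      using inv by (simp add: searching_def)
    moreover have "extends s ?t"
      using True by (auto simp: extends_def)
    ultimately show ?thesis
      using \<open>ivar s ''label'' \<noteq> 0\<close> unfolding s by simp
  qed
  then show "searching h w u S ?s" "extends s ?s"
    "cval b s \<Longrightarrow> iarr ?s ''component'' ?y \<noteq> 0"
    by blast+
qed

text \<open>One statement for all four directions: \<open>a\<close> and \<open>k\<close> select
  horizontal or vertical, \<open>be\<close> forward or backward. Tests refer to the state
  \<open>s0\<close> before the first visit, \<open>s\<close> is the state reached so far, so that
  four applications chain.\<close>

lemma visit_neighbour_correct:
  assumes w: "1 \<le> w"
    and inv0: "searching h w u S s0" and x0: "ivar s0 ''x'' \<in> pixels h w"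
    and label0: "ivar s0 ''label'' = iarr s0 ''component'' (ivar s0 ''x'')"
      "ivar s0 ''label'' \<noteq> 0"
    and inv: "searching h w u S s" and ext: "extends s0 s"
    and a: "a = ''r'' \<and> k = IConst 1 \<or> a = ''d'' \<and> k = IVar ''w''"
    and be: "b = Equal (IArr a (IVar ''x'')) (IConst 1) \<and> e = IPlus (IVar ''x'') k \<or>
      b = Equal (IArr a (IMinus (IVar ''x'') k)) (IConst 1) \<and> e = IMinus (IVar ''x'') k"
  shows "searching h w u S (run (visit b e) s)" "extends s0 (run (visit b e) s)"
    "cval b s0 \<Longrightarrow> iarr (run (visit b e) s) ''component'' (ival e s0) \<noteq> 0"
    "extends s (run (visit b e) s)"
proof -
  have "ivar s ''x'' = ivar s0 ''x''" "ivar s ''w'' = ivar s0 ''w''"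
      "iarr s ''r'' = iarr s0 ''r''" "iarr s ''d'' = iarr s0 ''d''"
    using ext by (simp_all add: extends_def)
  then have same: "cval b s = cval b s0" "ival e s = ival e s0"
    using a be by auto
  have st: "edges_stored h w S (iarr s0 ''r'') (iarr s0 ''d'') (h * w + 1)"
      and "ivar s0 ''w'' = w"
    using inv0 by (simp_all add: searching_def is_input_def)
  then have "adjacent h w S (ivar s0 ''x'') (ival e s0)" if "cval b s0"
    using that a be unfolding adjacent_iff[OF st w x0] by auto
  then have "linked (cut_graph h w S) (ivar s0 ''x'') (ival e s0)" if "cval b s0"
    using that adjacent_linked by blast
  moreover have "linked (cut_graph h w S) (ivar s0 ''label'') (ivar s0 ''x'')"
    using inv0 x0 label0 by (auto simp: searching_def search_inv_def)
  moreover have "ivar s ''label'' = ivar s0 ''label''"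
    using ext by (simp add: extends_def)
  ultimately have link: "linked (cut_graph h w S) (ivar s ''label'') (ival e s)" if "cval b s"
    using that same linked_simps(1) by metis
  have "ival e (s\<lparr>iarr := f\<rparr>) = ival e s" for f
    using a be by auto
  note * = visit_correct[OF inv link this]
  from * show "searching h w u S (run (visit b e) s)" "extends s (run (visit b e) s)"
    by blast+
  then show "extends s0 (run (visit b e) s)"
    using ext extends_trans by blast
  show "iarr (run (visit b e) s) ''component'' (ival e s0) \<noteq> 0" if "cval b s0"
    using * that same by simp
qed

text \<open>The four cases of \<open>adjacent_iff\<close> match the four visits. A neighbour is
  labelled after its own visit and remains so by \<open>extends\<close>; this is the condition for
  removing \<open>x\<close> from the queue.\<close>

lemma visit_neighbours_correct:
  assumes w: "1 \<le> w"
    and inv: "searching h w u S s0" and x: "ivar s0 ''x'' \<in> pixels h w"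
    and label: "ivar s0 ''label'' = iarr s0 ''component'' (ivar s0 ''x'')"
      "ivar s0 ''label'' \<noteq> 0"
  shows "searching h w u S (run visit_neighbours s0)" "extends s0 (run visit_neighbours s0)"
    "adjacent h w S (ivar s0 ''x'') y \<Longrightarrow> iarr (run visit_neighbours s0) ''component'' y \<noteq> 0"
proof -
  let ?x = "IVar ''x''" and ?w = "IVar ''w''" and ?one = "IConst 1"
  define s1 where "s1 = run (visit (Equal (IArr ''r'' ?x) ?one) (IPlus ?x ?one)) s0"
  define s2 where "s2 = run (visit (Equal (IArr ''r'' (IMinus ?x ?one)) ?one) (IMinus ?x ?one)) s1"
  define s3 where "s3 = run (visit (Equal (IArr ''d'' ?x) ?one) (IPlus ?x ?w)) s2"
  define s4 where "s4 = run (visit (Equal (IArr ''d'' (IMinus ?x ?w)) ?one) (IMinus ?x ?w)) s3"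
  have s4: "run visit_neighbours s0 = s4"
    by (simp add: visit_neighbours_def s1_def s2_def s3_def s4_def)
  note visit = visit_neighbour_correct[OF w inv x label]
  note v1 = visit[OF inv extends_refl, of "''r''" ?one "Equal (IArr ''r'' ?x) ?one" "IPlus ?x ?one",
      folded s1_def, simplified]
  note v2 = visit[OF v1(1,2), of "''r''" ?one "Equal (IArr ''r'' (IMinus ?x ?one)) ?one" "IMinus ?x ?one",
      folded s2_def, simplified]
  note v3 = visit[OF v2(1,2), of "''d''" ?w "Equal (IArr ''d'' ?x) ?one" "IPlus ?x ?w",
      folded s3_def, simplified]
  note v4 = visit[OF v3(1,2), of "''d''" ?w "Equal (IArr ''d'' (IMinus ?x ?w)) ?one" "IMinus ?x ?w",
      folded s4_def, simplified]
  show "searching h w u S (run visit_neighbours s0)" "extends s0 (run visit_neighbours s0)"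
    using v4 by (simp_all add: s4)
  have st: "edges_stored h w S (iarr s0 ''r'') (iarr s0 ''d'') (h * w + 1)"
      and sw: "ivar s0 ''w'' = w"
    using inv by (simp_all add: searching_def is_input_def)
  have mono: "iarr s' ''component'' y \<noteq> 0"
    if "extends s s'" "iarr s ''component'' y \<noteq> 0" for s s'
    using that by (simp add: extends_def)
  assume "adjacent h w S (ivar s0 ''x'') y"
  then consider "iarr s0 ''r'' (ivar s0 ''x'') = 1" "y = ivar s0 ''x'' + 1"
    | "iarr s0 ''r'' (ivar s0 ''x'' - 1) = 1" "y = ivar s0 ''x'' - 1"
    | "iarr s0 ''d'' (ivar s0 ''x'') = 1" "y = ivar s0 ''x'' + w"
    | "iarr s0 ''d'' (ivar s0 ''x'' - w) = 1" "y = ivar s0 ''x'' - w"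
    unfolding adjacent_iff[OF st w x] by blast
  then have "iarr s4 ''component'' y \<noteq> 0"
  proof cases
    case 1
    then have "iarr s1 ''component'' y \<noteq> 0"
      using v1(3) by simp
    then show ?thesis
      using mono v2(4) v3(4) v4(4) by blast
  next
    case 2
    then have "iarr s2 ''component'' y \<noteq> 0"
      using v2(3) by simp
    then show ?thesis
      using mono v3(4) v4(4) by blast
  next
    case 3
    then have "iarr s3 ''component'' y \<noteq> 0"
      using v3(3) sw by simp
    then show ?thesis
      using mono v4(4) by blast
  next
    case 4
    then show ?thesis
      using v4(3) sw by simp
  qed
  then show "iarr (run visit_neighbours s0) ''component'' y \<noteq> 0"
    by (simp add: s4)
qed

lemma search_step_correct:
  assumes w: "1 \<le> w" and inv: "searching h w u S s"
    and continue: "ivar s ''head'' < ivar s ''tail'' \<or> ivar s ''i'' \<le> h * w"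
  defines "s' \<equiv> run search_step s"
  shows "searching h w u S s'"
    and "ivar s' ''head'' + ivar s' ''i'' = ivar s ''head'' + ivar s ''i'' + 1"
proof -
  have sinv: "search_inv h w S (iarr s ''component'') (iarr s ''queue'')
      (ivar s ''head'') (ivar s ''tail'') (ivar s ''label'') (ivar s ''i'')"
    using inv by (simp add: searching_def)
  have "searching h w u S s' \<and>
    ivar s' ''head'' + ivar s' ''i'' = ivar s ''head'' + ivar s ''i'' + 1"
  proof (cases "ivar s ''head'' < ivar s ''tail''")
    case True
    let ?x = "iarr s ''queue'' (ivar s ''head'')"
    define s0 where "s0 = s\<lparr>ivar := (ivar s)(''x'' := ?x)\<rparr>"
    define s1 where "s1 = run visit_neighbours s0"
    have s': "s' = s1\<lparr>ivar := (ivar s1)(''head'' := ivar s1 ''head'' + 1)\<rparr>"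
      using True by (simp add: s'_def search_step_def s1_def s0_def)
    have "is_input h w u S s0"
      by (rule is_input_cong[of h w u S s]) (use inv in \<open>simp_all add: searching_def s0_def\<close>)
    then have inv0: "searching h w u S s0"
      using inv by (simp add: searching_def s0_def)
    have "1 \<le> ivar s ''head''"
      using sinv by (simp add: search_inv_def)
    note x = search_inv_queue[OF sinv this True]
    have "iarr s ''component'' ?x = ivar s ''label''"
      using sinv True by (simp add: search_inv_def)
    then have label: "ivar s0 ''label'' = iarr s0 ''component'' (ivar s0 ''x'')"
        "ivar s0 ''label'' \<noteq> 0"
      using x by (simp_all add: s0_def)
    have x0: "ivar s0 ''x'' \<in> pixels h w"
      using x by (simp add: s0_def)
    note v = visit_neighbours_correct[OF w inv0 x0 label, folded s1_def]
    \<comment> \<open>Visits write to the queue only from the old \<open>tail\<close> on, so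
      position \<open>head\<close> still holds the pixel being processed.\<close>
    have ext: "ivar s1 ''head'' = ivar s ''head''" "ivar s1 ''i'' = ivar s ''i''"
        "iarr s1 ''queue'' (ivar s ''head'') = ?x" "ivar s ''tail'' \<le> ivar s1 ''tail''"
      using v(2) True by (simp_all add: extends_def s0_def)
    have "search_inv h w S (iarr s1 ''component'') (iarr s1 ''queue'')
        (ivar s1 ''head'' + 1) (ivar s1 ''tail'') (ivar s1 ''label'') (ivar s1 ''i'')"
    proof (rule search_inv_dequeue)
      show "search_inv h w S (iarr s1 ''component'') (iarr s1 ''queue'')
        (ivar s1 ''head'') (ivar s1 ''tail'') (ivar s1 ''label'') (ivar s1 ''i'')"
        using v(1) by (simp add: searching_def)
      show "ivar s1 ''head'' < ivar s1 ''tail''"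
        using ext True by simp
      fix y
      assume "adjacent h w S (iarr s1 ''queue'' (ivar s1 ''head'')) y"
      then show "iarr s1 ''component'' y \<noteq> 0"
        using ext by (intro v(3)) (simp add: s0_def)
    qed
    moreover have "is_input h w u S s'"
      unfolding s' by (rule is_input_cong[of h w u S s1]) (use v(1) in \<open>simp_all add: searching_def\<close>)
    ultimately have "searching h w u S s'"
      using v(1) by (simp add: searching_def s')
    then show ?thesis
      using ext by (simp add: s')
  next
    case False
    let ?i = "ivar s ''i''"
    define s0 where "s0 = s\<lparr>ivar := (ivar s)(''label'' := ?i)\<rparr>"
    \<comment> \<open>The guard is trivially true: an unlabelled \<open>i\<close> starts a new
      search, a labelled one is skipped. Either way \<open>i\<close> is labelled afterwards and the
      scan may advance.\<close>
    define s1 where "s1 = run (visit (Equal (IConst 0) (IConst 0)) (IVar ''i'')) s0"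
    have s': "s' = s1\<lparr>ivar := (ivar s1)(''i'' := ivar s1 ''i'' + 1)\<rparr>"
      using False by (simp add: s'_def search_step_def s1_def s0_def)
    have "is_input h w u S s0"
      by (rule is_input_cong[of h w u S s]) (use inv in \<open>simp_all add: searching_def s0_def\<close>)
    then have inv0: "searching h w u S s0"
      using inv search_inv_empty_queue[OF sinv False] by (simp add: searching_def s0_def)
    have i: "?i \<in> pixels h w"
      using continue False sinv by (simp add: search_inv_def mem_pixels)
    have link: "linked (cut_graph h w S) (ivar s0 ''label'') (ival (IVar ''i'') s0)"
      using linked_simps(4)[OF i] by (simp add: s0_def)
    have v: "searching h w u S s1" "extends s0 s1" "iarr s1 ''component'' (ivar s0 ''i'') \<noteq> 0"
      using visit_correct[OF inv0 link, of "Equal (IConst 0) (IConst 0)", folded s1_def] by simp_all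
    have ext: "ivar s1 ''head'' = ivar s ''head''" "ivar s1 ''i'' = ?i"
      using v(2) by (simp_all add: extends_def s0_def)
    have "search_inv h w S (iarr s1 ''component'') (iarr s1 ''queue'')
        (ivar s1 ''head'') (ivar s1 ''tail'') (ivar s1 ''label'') (ivar s1 ''i'' + 1)"
      using v i by (intro search_inv_next) (simp_all add: searching_def ext s0_def mem_pixels)
    moreover have "is_input h w u S s'"
      unfolding s' by (rule is_input_cong[of h w u S s1]) (use v(1) in \<open>simp_all add: searching_def\<close>)
    ultimately have "searching h w u S s'"
      using v(1) by (simp add: searching_def s')
    then show ?thesis
      using ext by (simp add: s')
  qed
  then show "searching h w u S s'"
    and "ivar s' ''head'' + ivar s' ''i'' = ivar s ''head'' + ivar s ''i'' + 1"
    by blast+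
qed

text \<open>Labels must be pixels because they address \<open>sum\<close> and \<open>count\<close>,
  which are cleared only there.\<close>

definition labelled :: "nat \<Rightarrow> nat \<Rightarrow> edge set \<Rightarrow> (nat \<Rightarrow> nat) \<Rightarrow> bool" where
  "labelled h w S lbl \<longleftrightarrow> (\<forall>i\<in>pixels h w. lbl i \<in> pixels h w \<and>
     (\<forall>j\<in>pixels h w. lbl i = lbl j \<longleftrightarrow> linked (cut_graph h w S) i j))"

lemma search_inv_initial:
  assumes "\<forall>i\<in>pixels h w. lbl i = 0"
  shows "search_inv h w S lbl q 1 1 cur 1"
  using assms by (auto simp: search_inv_def bij_betw_def)

lemma search_correct:
  assumes w: "1 \<le> w"
  shows "triple (h * w) (prepared h w u S (h * w + 1)) search
    (\<lambda>s. is_input h w u S s \<and> ivar s ''p'' = h * w \<and> labelled h w S (iarr s ''component'') \<and>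
      (\<forall>j\<in>pixels h w. rarr s ''sum'' j = 0 \<and> rarr s ''count'' j = 0))"
  unfolding search_def
proof (rule triple_Seq)
  let ?init = "Seq (SetIVar ''i'' (IConst 1))
      (Seq (SetIVar ''head'' (IConst 1)) (SetIVar ''tail'' (IConst 1)))"
  let ?b = "Neg (Conj (Neg (Less (IVar ''head'') (IVar ''tail'')))
        (Neg (Less (IVar ''i'') (IPlus (IVar ''p'') (IConst 1)))))"
  show "triple (h * w) (prepared h w u S (h * w + 1)) ?init (searching h w u S)"
  proof (rule triple_run)
    fix s
    assume pre: "prepared h w u S (h * w + 1) s"
    then have "is_input h w u S (run ?init s)"
      by - (rule is_input_cong[of h w u S s], simp_all add: prepared_def)
    then show "searching h w u S (run ?init s)"
      using pre search_inv_initial[of h w "iarr s ''component''" S]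
      by (simp add: searching_def prepared_def cleared_def mem_pixels)
  qed simp
  show "triple (h * w) (searching h w u S) (While ?b search_step)
    (\<lambda>s. is_input h w u S s \<and> ivar s ''p'' = h * w \<and> labelled h w S (iarr s ''component'') \<and>
      (\<forall>j\<in>pixels h w. rarr s ''sum'' j = 0 \<and> rarr s ''count'' j = 0))"
  proof (rule triple_While[where m = "\<lambda>s. 2 * (h * w + 1) - (ivar s ''head'' + ivar s ''i'')"])
    show "loop_free search_step"
      by (simp add: search_step_def visit_neighbours_def visit_def)
  next
    fix s
    assume inv: "searching h w u S s" and b: "cval ?b s"
    have p: "ivar s ''p'' = h * w"
      using inv by (simp add: searching_def)
    have sinv: "search_inv h w S (iarr s ''component'') (iarr s ''queue'')
        (ivar s ''head'') (ivar s ''tail'') (ivar s ''label'') (ivar s ''i'')"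
      using inv by (simp add: searching_def)
    have continue: "ivar s ''head'' < ivar s ''tail'' \<or> ivar s ''i'' \<le> h * w"
      using b p by auto
    have bounds: "ivar s ''head'' \<le> ivar s ''tail''" "ivar s ''i'' \<le> h * w + 1"
      using sinv by (simp_all add: search_inv_def)
    \<comment> \<open>While the loop runs, \<open>head\<close> or \<open>i\<close> is still below
      its limit p + 1, so the truncated difference is positive and really decreases.\<close>
    have "a + b < 2 * (p + 1)" if "a < c \<or> b \<le> p" "c \<le> p + 1" "a \<le> c" "b \<le> p + 1"
      for a b c p :: nat
      using that by arith
    from this[OF continue search_inv_tail_le[OF sinv] bounds] show "searching h w u S (run search_step s) \<and>
      2 * (h * w + 1) - (ivar (run search_step s) ''head'' + ivar (run search_step s) ''i'')
        < 2 * (h * w + 1) - (ivar s ''head'' + ivar s ''i'')"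
      using search_step_correct[OF w inv continue] by simp
  next
    fix s
    assume "searching h w u S s"
    \<comment> \<open>Both counters start at 1, which lowers the measure from 2(p + 1) to the
      admissible 2p.\<close>
    then have "1 \<le> ivar s ''head''" "1 \<le> ivar s ''i''"
      by (simp_all add: searching_def search_inv_def)
    then show "2 * (h * w + 1) - (ivar s ''head'' + ivar s ''i'') \<le> 2 * (h * w)"
      by simp
  next
    fix s
    assume inv: "searching h w u S s" and b: "\<not> cval ?b s"
    then have final: "\<not> ivar s ''head'' < ivar s ''tail''" "\<not> ivar s ''i'' < h * w + 1"
      by (simp_all add: searching_def)
    have "search_inv h w S (iarr s ''component'') (iarr s ''queue'')
        (ivar s ''head'') (ivar s ''tail'') (ivar s ''label'') (ivar s ''i'')"
      using inv by (simp add: searching_def)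
    then have "labelled h w S (iarr s ''component'')"
      using search_inv_final[OF _ final] by (simp add: labelled_def)
    then show "is_input h w u S s \<and> ivar s ''p'' = h * w \<and> labelled h w S (iarr s ''component'') \<and>
      (\<forall>j\<in>pixels h w. rarr s ''sum'' j = 0 \<and> rarr s ''count'' j = 0)"
      using inv by (simp add: searching_def)
  qed
qed

section \<open>Component sums, component sizes and their quotients\<close>

definition add_pixel :: com where
  "add_pixel =
    Seq (SetRArr ''sum'' (IArr ''component'' (IVar ''i''))
      (RPlus (RArr ''sum'' (IArr ''component'' (IVar ''i''))) (RArr ''u'' (IVar ''i''))))
    (SetRArr ''count'' (IArr ''component'' (IVar ''i''))
      (RPlus (RArr ''count'' (IArr ''component'' (IVar ''i''))) ROne))"

text \<open>Sizes live in the real array \<open>count\<close>, since they are divisors later and the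
  machine has no conversion from naturals to reals. Cells at pixels that are not labels stay 0,
  matching the empty set.\<close>

definition summed ::
    "nat \<Rightarrow> nat \<Rightarrow> (nat \<Rightarrow> real) \<Rightarrow> edge set \<Rightarrow> nat \<Rightarrow> state \<Rightarrow> bool" where
  "summed h w u S n s \<longleftrightarrow> is_input h w u S s \<and> ivar s ''p'' = h * w \<and>
     labelled h w S (iarr s ''component'') \<and>
     (\<forall>L\<in>pixels h w.
        rarr s ''sum'' L = sum u {l \<in> {1..<n}. iarr s ''component'' l = L} \<and>
        rarr s ''count'' L = card {l \<in> {1..<n}. iarr s ''component'' l = L})"

lemma summed_step:
  assumes inv: "summed h w u S (ivar s ''i'') s" and i: "ivar s ''i'' \<in> {1..h * w}"
  shows "summed h w u S (ivar s ''i'' + 1) (run (Inc ''i'') (run add_pixel s))"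
    and "ivar (run add_pixel s) ''i'' = ivar s ''i''"
proof -
  let ?i = "ivar s ''i''" and ?c = "iarr s ''component''"
  have pix: "?i \<in> pixels h w"
    using i by (simp add: mem_pixels)
  have u: "rarr s ''u'' ?i = u ?i"
    using inv pix by (simp add: summed_def is_input_def)
  have set: "{l \<in> {1..<?i + 1}. ?c l = L} =
      (if ?c ?i = L then insert ?i {l \<in> {1..<?i}. ?c l = L} else {l \<in> {1..<?i}. ?c l = L})" for L
    using i by (auto simp: less_Suc_eq)
  let ?s = "s\<lparr>ivar := (ivar s)(''i'' := ?i + 1),
    rarr := (rarr s)(''sum'' := (rarr s ''sum'')(?c ?i := rarr s ''sum'' (?c ?i) + u ?i),
      ''count'' := (rarr s ''count'')(?c ?i := rarr s ''count'' (?c ?i) + 1))\<rparr>"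
  have s: "run (Inc ''i'') (run add_pixel s) = ?s"
    by (simp add: add_pixel_def u)
  have "is_input h w u S ?s"
    by (rule is_input_cong[of h w u S s]) (use inv in \<open>simp_all add: summed_def\<close>)
  moreover have "rarr ?s ''sum'' L = sum u {l \<in> {1..<?i + 1}. ?c l = L}"
    "rarr ?s ''count'' L = card {l \<in> {1..<?i + 1}. ?c l = L}" if "L \<in> pixels h w" for L
    using inv that unfolding set by (auto simp: summed_def)
  ultimately show "summed h w u S (?i + 1) (run (Inc ''i'') (run add_pixel s))"
    using inv unfolding s by (simp add: summed_def)
  show "ivar (run add_pixel s) ''i'' = ?i"
    by (simp add: add_pixel_def)
qed

lemma summed_quotient:
  assumes inv: "summed h w u S (h * w + 1) s" and k: "k \<in> pixels h w"
  shows "rarr s ''sum'' (iarr s ''component'' k) / rarr s ''count'' (iarr s ''component'' k) =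
    projection h w S u k"
proof -
  let ?c = "iarr s ''component''"
  have "{l \<in> {1..<h * w + 1}. ?c l = ?c k} = {l \<in> pixels h w. ?c k = ?c l}"
    by (auto simp: mem_pixels)
  also have "\<dots> = {l. linked (cut_graph h w S) k l}"
    using inv k linked_simps(3) by (auto simp: summed_def labelled_def)
  finally show ?thesis
    using inv k by (simp add: summed_def labelled_def projection_eq_class_mean class_mean_def mean_def)
qed

definition divide_pixel :: com where
  "divide_pixel = SetRArr ''proj'' (IVar ''i'')
    (RDivide (RArr ''sum'' (IArr ''component'' (IVar ''i'')))
      (RArr ''count'' (IArr ''component'' (IVar ''i''))))"

definition divided ::
    "nat \<Rightarrow> nat \<Rightarrow> (nat \<Rightarrow> real) \<Rightarrow> edge set \<Rightarrow> nat \<Rightarrow> state \<Rightarrow> bool" where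
  "divided h w u S n s \<longleftrightarrow> summed h w u S (h * w + 1) s \<and>
     (\<forall>k\<in>{1..<n}. rarr s ''proj'' k = projection h w S u k)"

lemma divided_step:
  assumes inv: "divided h w u S (ivar s ''i'') s" and i: "ivar s ''i'' \<in> {1..h * w}"
  shows "divided h w u S (ivar s ''i'' + 1) (run (Inc ''i'') (run divide_pixel s))"
    and "ivar (run divide_pixel s) ''i'' = ivar s ''i''"
proof -
  let ?i = "ivar s ''i''"
  let ?s = "s\<lparr>ivar := (ivar s)(''i'' := ?i + 1),
    rarr := (rarr s)(''proj'' := (rarr s ''proj'')(?i := projection h w S u ?i))\<rparr>"
  have summed: "summed h w u S (h * w + 1) s"
    using inv by (simp add: divided_def)
  then have s: "run (Inc ''i'') (run divide_pixel s) = ?s"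
    using summed_quotient[of h w u S s ?i] i by (simp add: divide_pixel_def mem_pixels)
  have "is_input h w u S ?s"
    by (rule is_input_cong[of h w u S s]) (use summed in \<open>simp_all add: summed_def\<close>)
  then have "summed h w u S (h * w + 1) ?s"
    using summed by (simp add: summed_def)
  then show "divided h w u S (?i + 1) (run (Inc ''i'') (run divide_pixel s))"
    using inv unfolding s by (auto simp: divided_def less_Suc_eq)
  show "ivar (run divide_pixel s) ''i'' = ?i"
    by (simp add: divide_pixel_def)
qed

lemma summed_upd_i: "summed h w u S n (s\<lparr>ivar := (ivar s)(''i'' := v)\<rparr>) \<longleftrightarrow> summed h w u S n s"
proof -
  have "is_input h w u S (s\<lparr>ivar := (ivar s)(''i'' := v)\<rparr>) \<longleftrightarrow> is_input h w u S s"
    by (auto intro: is_input_cong[of h w u S s]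
        is_input_cong[of h w u S "s\<lparr>ivar := (ivar s)(''i'' := v)\<rparr>" s])
  then show ?thesis
    by (simp add: summed_def)
qed

lemma sums_correct:
  "triple (h * w)
    (\<lambda>s. is_input h w u S s \<and> ivar s ''p'' = h * w \<and> labelled h w S (iarr s ''component'') \<and>
      (\<forall>j\<in>pixels h w. rarr s ''sum'' j = 0 \<and> rarr s ''count'' j = 0))
    (Seq (SetIVar ''i'' (IConst 1)) (For_pixels add_pixel))
    (summed h w u S (h * w + 1))"
proof (rule triple_For_pixels[where I = "\<lambda>s. summed h w u S (ivar s ''i'') s \<and>
      1 \<le> ivar s ''i'' \<and> ivar s ''i'' \<le> h * w + 1"])
  show "loop_free add_pixel"
    by (simp add: add_pixel_def)
next
  fix s
  assume "is_input h w u S s \<and> ivar s ''p'' = h * w \<and> labelled h w S (iarr s ''component'') \<and>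
      (\<forall>j\<in>pixels h w. rarr s ''sum'' j = 0 \<and> rarr s ''count'' j = 0)"
  then have "summed h w u S 1 s"
    by (simp add: summed_def)
  then show "summed h w u S (ivar (s\<lparr>ivar := (ivar s)(''i'' := 1)\<rparr>) ''i'')
        (s\<lparr>ivar := (ivar s)(''i'' := 1)\<rparr>) \<and>
      1 \<le> ivar (s\<lparr>ivar := (ivar s)(''i'' := 1)\<rparr>) ''i'' \<and>
      ivar (s\<lparr>ivar := (ivar s)(''i'' := 1)\<rparr>) ''i'' \<le> h * w + 1"
    by (simp add: summed_upd_i)
next
  fix s
  assume s: "summed h w u S (ivar s ''i'') s \<and> 1 \<le> ivar s ''i'' \<and> ivar s ''i'' \<le> h * w + 1"
    and i: "ivar s ''i'' \<in> {1..h * w}"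
  have "ivar (run (Inc ''i'') t) ''i'' = ivar t ''i'' + 1" for t
    by simp
  note * = this[of "run add_pixel s", unfolded summed_step(2)[OF conjunct1[OF s] i]]
  show "(summed h w u S (ivar (run (Inc ''i'') (run add_pixel s)) ''i'')
        (run (Inc ''i'') (run add_pixel s)) \<and>
      1 \<le> ivar (run (Inc ''i'') (run add_pixel s)) ''i'' \<and>
      ivar (run (Inc ''i'') (run add_pixel s)) ''i'' \<le> h * w + 1) \<and>
    ivar (run add_pixel s) ''i'' = ivar s ''i''"
    unfolding * using summed_step[OF conjunct1[OF s] i] i by simp
qed (auto simp: summed_def)

lemma divide_correct:
  "triple (h * w) (summed h w u S (h * w + 1))
    (Seq (SetIVar ''i'' (IConst 1)) (For_pixels divide_pixel)) (is_output h w u S)"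
proof (rule triple_For_pixels[where I = "\<lambda>s. divided h w u S (ivar s ''i'') s \<and>
      1 \<le> ivar s ''i'' \<and> ivar s ''i'' \<le> h * w + 1"])
  show "loop_free divide_pixel"
    by (simp add: divide_pixel_def)
next
  fix s
  assume "summed h w u S (h * w + 1) s"
  then show "divided h w u S (ivar (s\<lparr>ivar := (ivar s)(''i'' := 1)\<rparr>) ''i'')
        (s\<lparr>ivar := (ivar s)(''i'' := 1)\<rparr>) \<and>
      1 \<le> ivar (s\<lparr>ivar := (ivar s)(''i'' := 1)\<rparr>) ''i'' \<and>
      ivar (s\<lparr>ivar := (ivar s)(''i'' := 1)\<rparr>) ''i'' \<le> h * w + 1"
    by (simp add: divided_def summed_upd_i)
next
  fix s
  assume s: "divided h w u S (ivar s ''i'') s \<and> 1 \<le> ivar s ''i'' \<and> ivar s ''i'' \<le> h * w + 1"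
    and i: "ivar s ''i'' \<in> {1..h * w}"
  have "ivar (run (Inc ''i'') t) ''i'' = ivar t ''i'' + 1" for t
    by simp
  note * = this[of "run divide_pixel s", unfolded divided_step(2)[OF conjunct1[OF s] i]]
  show "(divided h w u S (ivar (run (Inc ''i'') (run divide_pixel s)) ''i'')
        (run (Inc ''i'') (run divide_pixel s)) \<and>
      1 \<le> ivar (run (Inc ''i'') (run divide_pixel s)) ''i'' \<and>
      ivar (run (Inc ''i'') (run divide_pixel s)) ''i'' \<le> h * w + 1) \<and>
    ivar (run divide_pixel s) ''i'' = ivar s ''i''"
    unfolding * using divided_step[OF conjunct1[OF s] i] i by simp
next
  fix s
  assume s: "divided h w u S (ivar s ''i'') s \<and> 1 \<le> ivar s ''i'' \<and> ivar s ''i'' \<le> h * w + 1"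
    and i: "ivar s ''i'' = h * w + 1"
  have "labelled h w S (iarr s ''component'')"
    using s by (simp add: divided_def summed_def)
  then show "is_output h w u S s"
    using s i wf_digraph.linked_iff_component[OF wf_digraph_cut_graph, of h w S]
    by (auto simp: is_output_def divided_def labelled_def mem_pixels)
qed (auto simp: divided_def summed_def)

section \<open>The complete program and the theorem\<close>

definition project :: com where
  "project = Seq count_pixels (Seq prepare (Seq search
    (Seq (Seq (SetIVar ''i'' (IConst 1)) (For_pixels add_pixel))
      (Seq (SetIVar ''i'' (IConst 1)) (For_pixels divide_pixel)))))"

lemma project_correct:
  "1 \<le> w \<Longrightarrow> triple (h * w) (is_input h w u S) project (is_output h w u S)"
  unfolding project_def
  by (intro triple_Seq[OF count_pixels_correct] triple_Seq[OF prepare_correct]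
      triple_Seq[OF search_correct] triple_Seq[OF sums_correct] divide_correct)

theorem proposition1:
  shows
    "(\<forall>(h::nat) (w::nat) (u :: nat \<Rightarrow> real) (\<gamma> :: edge \<Rightarrow> real) (S :: edge set) (C::nat)
        (G :: nat \<Rightarrow> (nat, edge) pre_digraph).
        h \<ge> 1 \<longrightarrow> w \<ge> 1 \<longrightarrow>
        u \<in> vectors (pixels h w) \<longrightarrow> \<gamma> \<in> vectors (grid_edges h w) \<longrightarrow>
        S = supp (grid_edges h w) \<gamma> \<longrightarrow>
        bij_betw G {1..C} (components (cut_graph h w S)) \<longrightarrow>
          (\<exists>!u'. is_arg_min (distance h w u) (feasible h w S) u') \<and>
          pixels h w = (\<Union>c\<in>{1..C}. verts (G c)) \<and>
          (\<forall>c\<in>{1..C}. \<forall>j\<in>verts (G c). projection h w S u j = mean u (verts (G c))))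
     \<and>
     (\<exists>(prog :: com) (T :: nat \<Rightarrow> nat).
        (\<lambda>p. real (T p)) \<in> O(\<lambda>p. real p) \<and>
        (\<forall>(h::nat) (w::nat) (u :: nat \<Rightarrow> real) (\<gamma> :: edge \<Rightarrow> real) (S :: edge set) (s :: state).
           h \<ge> 1 \<longrightarrow> w \<ge> 1 \<longrightarrow>
           u \<in> vectors (pixels h w) \<longrightarrow> \<gamma> \<in> vectors (grid_edges h w) \<longrightarrow>
           S = supp (grid_edges h w) \<gamma> \<longrightarrow>
           is_input h w u S s \<longrightarrow>
             (\<exists>t s'. exec prog s t s' \<and> t \<le> T (h * w) \<and> is_output h w u S s')))"
    (is "?projection \<and> ?linear_time")
proof
  show ?projection
  proof (intro allI impI conjI)
    fix h w u S C and G :: "nat \<Rightarrow> (nat, edge) pre_digraph"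
    assume "bij_betw G {1..C} (components (cut_graph h w S))"
    then have G: "G ` {1..C} = components (cut_graph h w S)"
      by (simp add: bij_betw_def)
    show "\<exists>!u'. is_arg_min (distance h w u) (feasible h w S) u'"
      by (simp add: is_arg_min_distance_iff)
    have "(\<Union>c\<in>{1..C}. verts (G c)) = (\<Union>H\<in>G ` {1..C}. verts H)"
      by simp
    then show "pixels h w = (\<Union>c\<in>{1..C}. verts (G c))"
      unfolding G using wf_digraph.Union_verts_components[OF wf_digraph_cut_graph, of h w S] by simp
    show "\<forall>c\<in>{1..C}. \<forall>j\<in>verts (G c). projection h w S u j = mean u (verts (G c))"
      using G projection_component_mean by blast
  qed
  \<comment> \<open>\<open>slope project\<close> depends on the program text alone, so the bound is
    affine in p with constant coefficients.\<close>
  have "(\<lambda>p. real (slope project * (p + 1))) \<in> O(\<lambda>p. real p)"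
    unfolding of_nat_mult by real_asymp
  then show ?linear_time
    using project_correct unfolding triple_def
    by (intro exI[of _ project] exI[of _ "\<lambda>p. slope project * (p + 1)"] conjI allI impI) blast+
qed

end
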